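(* Suppose coherent downlink transmission with MR precoding based on the LS estimator is used, i.e. $\mathbf w_k=\mathbf D_k^{1/2}\hat{\mathbf h}^{\mathrm{ls}}_k$ for every UE $k$, where $\mathbf D_k=\mathrm{diag}\big(\rho_{1,k}/\mathbb E\{|\hat h^{\mathrm{ls}}_{1,k}|^2\},\dots,\rho_{M,k}/\mathbb E\{|\hat h^{\mathrm{ls}}_{M,k}|^2\}\big)$. Then for all UEs $k,l$: $$\mathbb E\{\mathbf w_k^H\mathbf h_k\}=\mathrm{tr}(\mathbf D_k^{1/2}\mathbf R'_k),$$ $$\mathbb E\{|\mathbf w_l^H\mathbf h_k|^2\}=\frac{1}{\hat p_l\tau_p}\mathrm{tr}\big(\mathbf D_l(\boldsymbol\Lambda'_l)^{-1}\mathbf R'_k\big)+\begin{cases}T^{\mathrm{ls},(2)}_{k,l},& l\in\mathcal P_k,\\ 0,& l\notin\mathcal P_k,\end{cases}$$ where $$T^{\mathrm{ls},(2)}_{k,l}=\frac{\hat p_k}{\hat p_l}\Big[\mathrm{tr}\big(\mathbf D_l(\mathbf R_k^2+2\mathbf L_k\mathbf R_k)\big)+\big|\mathrm{tr}(\mathbf D_l^{1/2}\mathbf R'_k)\big|^2-\mathrm{tr}\big(\mathbf D_l(\mathbf R'_k)^2\big)\Big].$$ Consequently the coherent downlink effective SINR of UE $k$ equals $$\gamma^{\mathrm{dl,ls}}_k=\frac{\big|\mathrm{tr}(\mathbf D_k^{1/2}\mathbf R'_k)\big|^2}{\sum_{l=1}^K\frac{1}{\hat p_l\tau_p}\mathrm{tr}\big(\mathbf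 D_l(\boldsymbol\Lambda'_l)^{-1}\mathbf R'_k\big)+\sum_{l\in\mathcal P_k}T^{\mathrm{ls},(2)}_{k,l}-\big|\mathrm{tr}(\mathbf D_k^{1/2}\mathbf R'_k)\big|^2+\sigma^2_{\mathrm{dl}}}.$$
   Context: Channels. There are $M$ single-antenna access points (APs) and $K$ single-antenna users (UEs). The channel between AP $m$ and UE $k$ is $h_{m,k}=\bar h_{m,k}e^{j\varphi_{m,k}}+g_{m,k}$, with $\bar h_{m,k}\ge 0$ deterministic, $\varphi_{m,k}$ uniform on $[-\pi,\pi]$, $g_{m,k}\sim\mathcal N_{\mathbb C}(0,\beta_{m,k})$ (circularly symmetric complex Gaussian), $\beta_{m,k}>0$; all $\varphi_{m,k},g_{m,k}$ are mutually independent over $m,k$. Write $\mathbf h_k=[h_{1,k},\dots,h_{M,k}]^T$. Pilots. $\tau_p<K$ is the pilot length. Each UE uses one of $\tau_p$ mutually orthogonal pilot sequences $\boldsymbol\phi_k\in\mathbb C^{\tau_p}$ with $\|\boldsymbol\phi_k\|^2=\tau_p$, with pilot power $\hat p_k>0$. $\mathcal P_k$ is the set of UEs using the same pilot as UE $k$ (including $k$). After correlation with the pilot, AP $m$ has $$y^p_{m,k}=\sum_{l\in\mathcal P_k}\sqrt{\hat p_l}\,\tau_p h_{m,l}+\boldsymbol\phi_k^H\mathbf n^p_m,$$ where the $\mathbf n^p_m\sim\mathcal N_{\mathbb C}(\mathbf 0,\sigma^2_{\mathrm{ul}}\mathbf I_{\tau_p})$ are independent over $m$ and independent of all channels, and $\sigma^2_{\mathrm{ul}}>0$.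 LS estimator: $\hat h^{\mathrm{ls}}_{m,k}=\frac{1}{\sqrt{\hat p_k}\,\tau_p}y^p_{m,k}$; $\hat{\mathbf h}^{\mathrm{ls}}_k=[\hat h^{\mathrm{ls}}_{1,k},\dots,\hat h^{\mathrm{ls}}_{M,k}]^T$. Notation: $\beta'_{m,k}=\beta_{m,k}+\bar h_{m,k}^2$, $\lambda'_{m,k}=\sum_{l\in\mathcal P_k}\hat p_l\tau_p\beta'_{m,l}+\sigma^2_{\mathrm{ul}}$. Matrices (all $M\times M$ diagonal): $\mathbf R_k=\mathrm{diag}(\beta_{1,k},\dots,\beta_{M,k})$, $\mathbf L_k=\mathrm{diag}(\bar h_{1,k}^2,\dots,\bar h_{M,k}^2)$, $\mathbf R'_k=\mathbf R_k+\mathbf L_k$, $\boldsymbol\Lambda'_k=\mathrm{diag}(\lambda'_{1,k},\dots,\lambda'_{M,k})^{-1}$. Coherent downlink. The powers $\rho_{m,k}\ge 0$ are deterministic (with $\sum_{l}\rho_{m,l}\le\rho^{\mathrm{dl}}$ for each AP $m$). UE $k$ receives $\mathbf h_k^H\mathbf w_k\varsigma_k+\sum_{l\ne k}\mathbf h_k^H\mathbf w_l\varsigma_l+n^{\mathrm{dl}}_k$ with independent unit-variance data symbols $\varsigma_l\sim\mathcal N_{\mathbb C}(0,1)$ and noise $n^{\mathrm{dl}}_k\sim\mathcal N_{\mathbb C}(0,\sigma^2_{\mathrm{dl}})$, $\sigma^2_{\mathrm{dl}}>0$. The coherent downlink effective SINR of UE $k$ (from the use-and-then-forget bound, SE $=\frac{\tau_d}{\tau_c}\log_2(1+\gamma)$)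 is defined as $$\gamma^{\mathrm{dl,coh}}_k=\frac{|\mathbb E\{\mathbf w_k^H\mathbf h_k\}|^2}{\sum_{l=1}^K\mathbb E\{|\mathbf w_l^H\mathbf h_k|^2\}-|\mathbb E\{\mathbf w_k^H\mathbf h_k\}|^2+\sigma^2_{\mathrm{dl}}}.$$ *)

theory Defs
  imports "HOL-Probability.Probability"
begin

section \<open>Matrices and vectors\<close>

definition diag_mat :: "('m::finite \<Rightarrow> 'a::zero) \<Rightarrow> 'a ^ 'm ^ 'm" where
  "diag_mat d = (\<chi> i j. if i = j then d i else 0)"

text \<open>The root \<open>A\<^sup>1\<^sup>/\<^sup>2\<close> of a diagonal matrix \<open>A\<close> with nonnegative entries. Taking entrywise roots
  is adequate for diagonal matrices only; see the two lemmas below.\<close>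

definition diag_sqrt :: "real ^ 'm ^ 'm \<Rightarrow> real ^ 'm ^ 'm::finite" where
  "diag_sqrt A = map_matrix sqrt A"

lemma diag_sqrt_diag_mat: "diag_sqrt (diag_mat d) = diag_mat (\<lambda>i. sqrt (d i))"
  by (simp add: diag_sqrt_def diag_mat_def vec_eq_iff)

lemma diag_sqrt_square:
  assumes "\<And>i. 0 \<le> d i"
  shows "diag_sqrt (diag_mat d) ** diag_sqrt (diag_mat d) = diag_mat d"
  using assms unfolding diag_sqrt_diag_mat
  by (simp add: vec_eq_iff diag_mat_def matrix_matrix_mult_def
      if_distrib[of "\<lambda>x. x * _"] if_distrib[of "\<lambda>x. _ * x"] cong: if_cong)

text \<open>The product \<open>x\<^sup>H y\<close>, conjugate-linear in the first argument.\<close>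

definition herm :: "complex ^ 'n \<Rightarrow> complex ^ 'n::finite \<Rightarrow> complex" where
  "herm x y = (\<Sum>i\<in>UNIV. cnj (x $ i) * y $ i)"


section \<open>Circularly symmetric complex Gaussian variables\<close>

text \<open>\<open>Z\<close> has law \<open>N\<^sub>\<complex>(0, v)\<close>, \<open>v > 0\<close>: its real and imaginary parts are independent real
  Gaussians, each of mean 0 and variance \<open>v / 2\<close>.\<close>

definition complex_normal :: "'w measure \<Rightarrow> ('w \<Rightarrow> complex) \<Rightarrow> real \<Rightarrow> bool" where
  "complex_normal P Z v \<longleftrightarrow>
     prob_space.indep_var P borel (\<lambda>\<omega>. Re (Z \<omega>)) borel (\<lambda>\<omega>. Im (Z \<omega>)) \<and>
     distributed P lborel (\<lambda>\<omega>. Re (Z \<omega>)) (normal_density 0 (sqrt (v / 2))) \<and>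
     distributed P lborel (\<lambda>\<omega>. Im (Z \<omega>)) (normal_density 0 (sqrt (v / 2)))"

text \<open>\<open>X\<close> has law \<open>N\<^sub>\<complex>(0, v I)\<close>: covariance \<open>v I\<close> means independent \<open>N\<^sub>\<complex>(0, v)\<close> entries.\<close>

definition complex_normal_vec :: "'w measure \<Rightarrow> ('w \<Rightarrow> complex ^ 'n::finite) \<Rightarrow> real \<Rightarrow> bool" where
  "complex_normal_vec P X v \<longleftrightarrow>
     prob_space.indep_vars P (\<lambda>_. borel) (\<lambda>i \<omega>. X \<omega> $ i) UNIV \<and>
     (\<forall>i. complex_normal P (\<lambda>\<omega>. X \<omega> $ i) v)"


section \<open>The network\<close>

text \<open>The index types are \<open>'m\<close> (APs, \<open>M = CARD('m)\<close>), \<open>'k\<close> (UEs, \<open>K = CARD('k)\<close>) and \<open>'t\<close>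
  (\<open>\<tau>\<^sub>p = CARD('t)\<close>, both the pilot length and the number of pilot sequences).
  UE \<open>k\<close> transmits the sequence \<open>pilot S (pilot_of S k)\<close>.\<close>

record ('w, 'm, 'k, 't::finite) network =
  pspace   :: "'w measure"
  hbar     :: "'m \<Rightarrow> 'k \<Rightarrow> real"
  beta     :: "'m \<Rightarrow> 'k \<Rightarrow> real"
  phase    :: "'m \<Rightarrow> 'k \<Rightarrow> 'w \<Rightarrow> real"
  scatter  :: "'m \<Rightarrow> 'k \<Rightarrow> 'w \<Rightarrow> complex"
  pilot    :: "'t \<Rightarrow> complex ^ 't"
  pilot_of :: "'k \<Rightarrow> 't"
  ppow     :: "'k \<Rightarrow> real"
  ul_noise :: "'m \<Rightarrow> 'w \<Rightarrow> complex ^ 't"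
  ul_var   :: real
  rho      :: "'m \<Rightarrow> 'k \<Rightarrow> real"
  rho_max  :: real
  dl_var   :: real

definition chan :: "('w, 'm, 'k, 't::finite) network \<Rightarrow> 'm \<Rightarrow> 'k \<Rightarrow> 'w \<Rightarrow> complex" where
  "chan S m k \<omega> = of_real (hbar S m k) * cis (phase S m k \<omega>) + scatter S m k \<omega>"

definition chan_vec ::
    "('w, 'm::finite, 'k, 't::finite) network \<Rightarrow> 'k \<Rightarrow> 'w \<Rightarrow> complex ^ 'm" where
  "chan_vec S k \<omega> = (\<chi> m. chan S m k \<omega>)"

definition tau_p :: "('w, 'm, 'k, 't::finite) network \<Rightarrow> real" where
  "tau_p S = real CARD('t)"

definition copilot :: "('w, 'm, 'k, 't::finite) network \<Rightarrow> 'k \<Rightarrow> 'k set" where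
  "copilot S k = {l. pilot_of S l = pilot_of S k}"

text \<open>Joint independence of the phases and scattered components is expressed through one
  complex-valued family over a disjoint sum; \<open>complex_of_real\<close> is only there to give both kinds of
  variables the same type and does not change the generated sigma-algebra.
  The noise family \<open>(n\<^sub>m)\<^sub>m\<close> and the channel family \<open>(h\<^sub>m\<^sub>k)\<^sub>m\<^sub>k\<close> take values in different types,
  so their independence is that of the sigma-algebras they generate.\<close>

locale cell_free = prob_space "pspace S"
  for S :: "('w, 'm::finite, 'k::finite, 't::finite) network" +
  assumes hbar_nonneg: "0 \<le> hbar S m k"
    and beta_pos: "0 < beta S m k"
    and phase_uniform: "distributed (pspace S) lborel (phase S m k)
          (\<lambda>x. indicator {-pi..pi} x / measure lborel {-pi..pi})"
    and scatter_normal: "complex_normal (pspace S) (scatter S m k) (beta S m k)"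
    and phase_scatter_indep:
      "indep_vars (\<lambda>_. borel)
         (case_sum (\<lambda>(m, k) \<omega>. complex_of_real (phase S m k \<omega>)) (\<lambda>(m, k). scatter S m k))
         (UNIV :: ('m \<times> 'k + 'm \<times> 'k) set)"
    and pilot_shorter: "CARD('t) < CARD('k)"
    and pilot_orthogonal: "i \<noteq> j \<Longrightarrow> herm (pilot S i) (pilot S j) = 0"
    and pilot_norm: "(norm (pilot S i))\<^sup>2 = tau_p S"
    and ppow_pos: "0 < ppow S k"
    and ul_var_pos: "0 < ul_var S"
    and ul_noise_normal: "complex_normal_vec (pspace S) (ul_noise S m) (ul_var S)"
    and ul_noise_indep: "indep_vars (\<lambda>_. borel) (ul_noise S) UNIV"
    and ul_noise_chan_indep:
      "indep_set
         (sets (vimage_algebra (space (pspace S)) (\<lambda>\<omega> m. ul_noise S m \<omega>)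
                  (Pi\<^sub>M UNIV (\<lambda>_. borel))))
         (sets (vimage_algebra (space (pspace S)) (\<lambda>\<omega> (m, k). chan S m k \<omega>)
                  (Pi\<^sub>M UNIV (\<lambda>_. borel))))"
    and rho_nonneg: "0 \<le> rho S m k"
    and rho_sum: "(\<Sum>l\<in>UNIV. rho S m l) \<le> rho_max S"
    and dl_var_pos: "0 < dl_var S"


section \<open>Pilot observations, LS estimates and channel statistics\<close>

definition pilot_obs ::
    "('w, 'm, 'k, 't::finite) network \<Rightarrow> 'm \<Rightarrow> 'k \<Rightarrow> 'w \<Rightarrow> complex" where
  "pilot_obs S m k \<omega> =
     (\<Sum>l\<in>copilot S k. of_real (sqrt (ppow S l) * tau_p S) * chan S m l \<omega>)
     + herm (pilot S (pilot_of S k)) (ul_noise S m \<omega>)"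

definition ls_est ::
    "('w, 'm, 'k, 't::finite) network \<Rightarrow> 'm \<Rightarrow> 'k \<Rightarrow> 'w \<Rightarrow> complex" where
  "ls_est S m k \<omega> = of_real (1 / (sqrt (ppow S k) * tau_p S)) * pilot_obs S m k \<omega>"

definition ls_est_vec ::
    "('w, 'm::finite, 'k, 't::finite) network \<Rightarrow> 'k \<Rightarrow> 'w \<Rightarrow> complex ^ 'm" where
  "ls_est_vec S k \<omega> = (\<chi> m. ls_est S m k \<omega>)"

definition beta' :: "('w, 'm, 'k, 't::finite) network \<Rightarrow> 'm \<Rightarrow> 'k \<Rightarrow> real" where
  "beta' S m k = beta S m k + (hbar S m k)\<^sup>2"

definition lambda' :: "('w, 'm, 'k, 't::finite) network \<Rightarrow> 'm \<Rightarrow> 'k \<Rightarrow> real" where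
  "lambda' S m k = (\<Sum>l\<in>copilot S k. ppow S l * tau_p S * beta' S m l) + ul_var S"

definition R_mat :: "('w, 'm::finite, 'k, 't::finite) network \<Rightarrow> 'k \<Rightarrow> real ^ 'm ^ 'm" where
  "R_mat S k = diag_mat (\<lambda>m. beta S m k)"

definition L_mat :: "('w, 'm::finite, 'k, 't::finite) network \<Rightarrow> 'k \<Rightarrow> real ^ 'm ^ 'm" where
  "L_mat S k = diag_mat (\<lambda>m. (hbar S m k)\<^sup>2)"

definition R'_mat :: "('w, 'm::finite, 'k, 't::finite) network \<Rightarrow> 'k \<Rightarrow> real ^ 'm ^ 'm" where
  "R'_mat S k = R_mat S k + L_mat S k"

text \<open>By convention \<open>\<Lambda>'\<close> is itself an inverse, so \<open>matrix_inv (Lambda'_mat S k)\<close> has the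
  \<open>lambda' S m k\<close> on its diagonal.\<close>

definition Lambda'_mat :: "('w, 'm::finite, 'k, 't::finite) network \<Rightarrow> 'k \<Rightarrow> real ^ 'm ^ 'm" where
  "Lambda'_mat S k = matrix_inv (diag_mat (\<lambda>m. lambda' S m k))"


section \<open>Coherent downlink\<close>

text \<open>The effective SINR of UE \<open>k\<close> given by the use-and-then-forget bound, for arbitrary random
  precoders \<open>w\<close>.\<close>

definition dl_coh_sinr ::
    "('w, 'm::finite, 'k::finite, 't::finite) network \<Rightarrow> ('k \<Rightarrow> 'w \<Rightarrow> complex ^ 'm) \<Rightarrow> 'k \<Rightarrow> real"
  where
  "dl_coh_sinr S w k =
     (cmod (\<integral>\<omega>. herm (w k \<omega>) (chan_vec S k \<omega>) \<partial>pspace S))\<^sup>2 /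
     ((\<Sum>l\<in>UNIV. \<integral>\<omega>. (cmod (herm (w l \<omega>) (chan_vec S k \<omega>)))\<^sup>2 \<partial>pspace S)
      - (cmod (\<integral>\<omega>. herm (w k \<omega>) (chan_vec S k \<omega>) \<partial>pspace S))\<^sup>2
      + dl_var S)"

end

theory Submission
  imports Defs
begin

text \<open>For different APs \<open>m\<close> the products \<open>X\<^sub>m = cnj y\<^sub>m * h\<^sub>m\<close> of the pilot observation used for UE
  \<open>l\<close> and the channel of UE \<open>k\<close> are independent, so the second moment of \<open>\<Sum>a\<^sub>m X\<^sub>m\<close> is the squared
  modulus of its mean plus the variances of the terms. At one AP, \<open>y = c h + z\<close> with real \<open>c\<close> and \<open>z\<close>
  centred and independent of \<open>h\<close>, whence \<open>E (cnj y * h) = c E|h|\<^sup>2\<close> and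
  \<open>E|y h|\<^sup>2 = c\<^sup>2 E|h|\<^sup>4 + E|z|\<^sup>2 E|h|\<^sup>2\<close>. The fourth moment of a Rician coefficient
  \<open>h = a U + g\<close>, \<open>|U| = 1\<close>, exceeds \<open>(E|h|\<^sup>2)\<^sup>2\<close> by \<open>v\<^sup>2 + 2 a\<^sup>2 v\<close>, where \<open>v = E|g|\<^sup>2\<close>; the part with
  phase is handled by \<open>2 (Re C)\<^sup>2 = |C|\<^sup>2 + Re C\<^sup>2\<close> for \<open>C = cnj U * g\<close>, as \<open>E C\<^sup>2 = 0\<close>.\<close>

section \<open>Independence and second moments\<close>

text \<open>Squared moduli are expanded as products with conjugates, which are complex; this
  equivalence carries the resulting expectations back to the reals.\<close>

lemma has_bochner_integral_of_real_iff:
  fixes f :: "'a \<Rightarrow> real" and c :: real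
  shows "has_bochner_integral M (\<lambda>x. complex_of_real (f x)) (of_real c) \<longleftrightarrow> has_bochner_integral M f c"
  by (simp add: has_bochner_integral_iff complex_of_real_integrable_eq)

lemma borel_measurable_cnj [measurable]: "cnj \<in> borel_measurable borel"
  by (intro borel_measurable_continuous_onI continuous_intros)

section \<open>Independence of functions of disjoint groups of variables\<close>

context prob_space
begin

text \<open>Disjoint blocks of an independent family are independent, and so are functions of the
  blocks. Linking \<open>Y\<close> to \<open>f\<close> by a pointwise equation lets concrete
  families be used in their own form.\<close>

lemma indep_vars_group:
  assumes "indep_vars M' X I" "\<And>j. j \<in> L \<Longrightarrow> K j \<subseteq> I" "disjoint_family_on K L"
    and f: "\<And>j. j \<in> L \<Longrightarrow> f j \<in> measurable (PiM (K j) M') (N j)"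
    and eq: "\<And>j \<omega>. j \<in> L \<Longrightarrow> Y j \<omega> = f j (\<lambda>i\<in>K j. X i \<omega>)"
  shows "indep_vars N Y L"
proof -
  have "indep_vars N (\<lambda>j \<omega>. f j (\<lambda>i\<in>K j. X i \<omega>)) L"
    by (rule indep_vars_compose2[OF indep_vars_restrict[OF assms(1-3)] f])
  then show ?thesis
    by (rule iffD1[OF indep_vars_cong, rotated 3]) (auto simp: eq)
qed

lemma indep_var_group:
  assumes "indep_vars M' X I" "A \<inter> B = {}" "A \<subseteq> I" "B \<subseteq> I"
    and f: "f \<in> measurable (PiM A M') N" and g: "g \<in> measurable (PiM B M') N'"
  shows "indep_var N (\<lambda>\<omega>. f (\<lambda>i\<in>A. X i \<omega>)) N' (\<lambda>\<omega>. g (\<lambda>i\<in>B. X i \<omega>))"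
  using indep_var_compose[OF indep_var_restrict[OF assms(1-4)] f g] by (simp add: comp_def)

lemma indep_vars_imp_indep_var:
  assumes X: "indep_vars M' X I" and ij: "i \<in> I" "j \<in> I" "i \<noteq> j"
  shows "indep_var (M' i) (X i) (M' j) (X j)"
proof -
  have "(\<lambda>x. x i) \<in> measurable (PiM {i} M') (M' i)" "(\<lambda>x. x j) \<in> measurable (PiM {j} M') (M' j)"
    by (auto intro: measurable_component_singleton)
  from indep_var_group[OF X _ _ _ this] ij show ?thesis by simp
qed

text \<open>A finite intersection of generating events splits into a left part in \<open>A\<close>
  and a right part in \<open>B\<close>. Its probability factors across the two by \<open>AB\<close>,
  then within each part by the independence of that family. This joins noise and channels, whose
  mutual independence is given only for sigma-algebras.\<close>

lemma indep_vars_case_sum: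
  assumes X: "indep_vars (\<lambda>_. N) X UNIV" and Y: "indep_vars (\<lambda>_. N) Y UNIV"
    and AB: "indep_set (sets A) (sets B)" "space A = space M" "space B = space M"
    and XA: "\<And>i. X i \<in> measurable A N" and YB: "\<And>j. Y j \<in> measurable B N"
  shows "indep_vars (\<lambda>_. N) (case_sum X Y) UNIV"
proof -
  have rv: "random_variable N (X i)" "random_variable N (Y j)" for i j
    using X Y by (auto simp: indep_vars_def2)
  have "indep_sets (\<lambda>i. {case_sum X Y i -` C \<inter> space M | C. C \<in> sets N}) UNIV"
  proof (rule indep_setsI)
    fix i show "{case_sum X Y i -` C \<inter> space M | C. C \<in> sets N} \<subseteq> events"
      by (cases i) (auto intro: measurable_sets[OF rv(1)] measurable_sets[OF rv(2)])
  next
    fix F J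
    assume J: "J \<noteq> {}" "finite (J :: ('b + 'd) set)"
      and F: "\<forall>j\<in>J. F j \<in> {case_sum X Y j -` C \<inter> space M | C. C \<in> sets N}"
    define J1 J2 where "J1 = Inl -` J" and "J2 = Inr -` J"
    have J_eq: "J = Inl ` J1 \<union> Inr ` J2"
      unfolding J1_def J2_def using sum.exhaust by (auto simp: image_iff) (metis sum.exhaust)
    have fin: "finite J1" "finite J2"
      using J unfolding J1_def J2_def by (auto intro: finite_vimageI)
    \<comment> \<open>Intersecting with the space turns an intersection over an empty index set into
      an event of probability 1, matching the empty product.\<close>
    define P Q where "P = (\<Inter>i\<in>J1. F (Inl i)) \<inter> space M" and "Q = (\<Inter>j\<in>J2. F (Inr j)) \<inter> space M"
    have F1: "F (Inl i) \<in> {X i -` C \<inter> space M | C. C \<in> sets N}" if "i \<in> J1" for i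
      using F that by (force simp: J1_def)
    have F2: "F (Inr j) \<in> {Y j -` C \<inter> space M | C. C \<in> sets N}" if "j \<in> J2" for j
      using F that by (force simp: J2_def)
    have "F (Inl i) \<in> sets A" if "i \<in> J1" for i
      using F1[OF that] measurable_sets[OF XA] AB(2) by auto
    then have PA: "P \<in> sets A"
      using fin sets.top[of A] AB(2) unfolding P_def
      by (cases "J1 = {}") (auto intro!: sets.Int sets.finite_INT)
    have "F (Inr i) \<in> sets B" if "i \<in> J2" for i
      using F2[OF that] measurable_sets[OF YB] AB(3) by auto
    then have QB: "Q \<in> sets B"
      using fin sets.top[of B] AB(3) unfolding Q_def
      by (cases "J2 = {}") (auto intro!: sets.Int sets.finite_INT)
    have P: "prob P = (\<Prod>i\<in>J1. prob (F (Inl i)))"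
    proof (cases "J1 = {}")
      case False
      then have "P = (\<Inter>i\<in>J1. F (Inl i))" using F1 by (auto simp: P_def)
      then show ?thesis
        using indep_setsD[OF X[unfolded indep_vars_def2, THEN conjunct2] _ False fin(1), of "\<lambda>i. F (Inl i)"] F1 by auto
    qed (simp add: P_def prob_space)
    have Q: "prob Q = (\<Prod>i\<in>J2. prob (F (Inr i)))"
    proof (cases "J2 = {}")
      case False
      then have "Q = (\<Inter>i\<in>J2. F (Inr i))" using F2 by (auto simp: Q_def)
      then show ?thesis
        using indep_setsD[OF Y[unfolded indep_vars_def2, THEN conjunct2] _ False fin(2), of "\<lambda>i. F (Inr i)"] F2 by auto
    qed (simp add: Q_def prob_space)
    have "(\<Inter>j\<in>J. F j) = P \<inter> Q"
    proof -
      have "F j \<subseteq> space M" if "j \<in> J" for j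
        using F that by auto
      then have "(\<Inter>j\<in>J. F j) \<subseteq> space M" using J(1) by blast
      then show ?thesis unfolding P_def Q_def J_eq by auto
    qed
    then have "prob (\<Inter>j\<in>J. F j) = prob P * prob Q"
      using indep_setD[OF AB(1) PA QB] by simp
    also have "\<dots> = (\<Prod>j\<in>J. prob (F j))"
      unfolding J_eq P Q using fin
      by (subst prod.union_disjoint) (auto simp: prod.reindex)
    finally show "prob (\<Inter>j\<in>J. F j) = (\<Prod>j\<in>J. prob (F j))" .
  qed
  then show ?thesis
    using rv by (auto simp: indep_vars_def2 split: sum.split)
qed

section \<open>Second moments of sums and products\<close>

lemma has_bochner_integral_indep_mult:
  fixes X Y :: "'a \<Rightarrow> 'b::{real_normed_field, banach, second_countable_topology}"
  assumes "indep_var borel X borel Y" "has_bochner_integral M X x" "has_bochner_integral M Y y"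
  shows "has_bochner_integral M (\<lambda>\<omega>. X \<omega> * Y \<omega>) (x * y)"
  using assms indep_var_integrable[OF assms(1)] indep_var_lebesgue_integral[OF assms(1)]
  by (auto simp: has_bochner_integral_iff)

text \<open>In the double sum for the squared modulus, independence factors each off-diagonal term
  into means. Adding and subtracting the diagonal products of means completes the double sum to the
  squared modulus of the total mean.\<close>

lemma has_bochner_integral_cmod_sum_square:
  fixes U :: "'i \<Rightarrow> 'a \<Rightarrow> complex"
  assumes indep: "\<And>i j. i \<in> J \<Longrightarrow> j \<in> J \<Longrightarrow> i \<noteq> j \<Longrightarrow> indep_var borel (U i) borel (U j)"
    and mean: "\<And>i. i \<in> J \<Longrightarrow> has_bochner_integral M (U i) (\<mu> i)"
    and sq: "\<And>i. i \<in> J \<Longrightarrow> has_bochner_integral M (\<lambda>\<omega>. (cmod (U i \<omega>))\<^sup>2) (s i)"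
  shows "has_bochner_integral M (\<lambda>\<omega>. (cmod (\<Sum>i\<in>J. U i \<omega>))\<^sup>2)
           ((cmod (\<Sum>i\<in>J. \<mu> i))\<^sup>2 + (\<Sum>i\<in>J. s i - (cmod (\<mu> i))\<^sup>2))"
proof (cases "finite J")
  case True
  define v where "v i j = (if i = j then complex_of_real (s i) else \<mu> i * cnj (\<mu> j))" for i j
  have "has_bochner_integral M (\<lambda>\<omega>. U i \<omega> * cnj (U j \<omega>)) (v i j)" if "i \<in> J" "j \<in> J" for i j
  proof (cases "i = j")
    case True
    then show ?thesis using sq[OF that(1)]
      by (simp add: v_def flip: has_bochner_integral_of_real_iff complex_norm_square)
  next
    case False
    have "indep_var borel (\<lambda>\<omega>. U i \<omega>) borel (\<lambda>\<omega>. cnj (U j \<omega>))"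
      using indep_var_compose[OF indep[OF that False] measurable_ident_sets[OF refl], of cnj borel]
      by (simp add: comp_def)
    from has_bochner_integral_indep_mult[OF this mean[OF that(1)] has_bochner_integral_cnj[OF mean[OF that(2)]]]
    show ?thesis using False by (simp add: v_def)
  qed
  then have "has_bochner_integral M (\<lambda>\<omega>. \<Sum>i\<in>J. \<Sum>j\<in>J. U i \<omega> * cnj (U j \<omega>)) (\<Sum>i\<in>J. \<Sum>j\<in>J. v i j)"
    by (intro has_bochner_integral_sum)
  moreover have "(\<Sum>i\<in>J. \<Sum>j\<in>J. U i \<omega> * cnj (U j \<omega>)) = of_real ((cmod (\<Sum>i\<in>J. U i \<omega>))\<^sup>2)" for \<omega>
    by (simp add: complex_norm_square sum_product cnj_sum del: of_real_power)
  moreover have "(\<Sum>i\<in>J. \<Sum>j\<in>J. v i j) =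
      of_real ((cmod (\<Sum>i\<in>J. \<mu> i))\<^sup>2 + (\<Sum>i\<in>J. s i - (cmod (\<mu> i))\<^sup>2))"
  proof -
    have "v i j = \<mu> i * cnj (\<mu> j) + (if i = j then of_real (s i) - \<mu> i * cnj (\<mu> i) else 0)" for i j
      by (simp add: v_def)
    then show ?thesis using True
      by (simp add: sum.distrib sum.delta' complex_norm_square sum_product cnj_sum of_real_sum
          del: of_real_power)
  qed
  ultimately show ?thesis
    by (simp only: has_bochner_integral_of_real_iff)
\<comment> \<open>For infinite \<open>J\<close> all the sums take the default value 0.\<close>
qed (simp add: has_bochner_integral_zero)

text \<open>The bound by 1 plus the higher power is integrable because the total mass is finite. It
  supplies the third absolute moments that occur in cross terms.\<close>

lemma integrable_cmod_mono:
  fixes f :: "'a \<Rightarrow> complex"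
  assumes f: "f \<in> borel_measurable M" and n: "integrable M (\<lambda>\<omega>. (cmod (f \<omega>)) ^ n)" and "m \<le> n"
  shows "integrable M (\<lambda>\<omega>. (cmod (f \<omega>)) ^ m)"
proof (rule Bochner_Integration.integrable_bound[of _ "\<lambda>\<omega>. 1 + (cmod (f \<omega>)) ^ n"])
  show "AE \<omega> in M. norm (cmod (f \<omega>) ^ m) \<le> norm (1 + cmod (f \<omega>) ^ n)"
  proof (rule AE_I2)
    fix \<omega>
    have "cmod (f \<omega>) ^ m \<le> 1 + cmod (f \<omega>) ^ n"
    proof (cases "cmod (f \<omega>) \<le> 1")
      case True
      then show ?thesis using power_le_one[of "cmod (f \<omega>)" m] by (simp add: add_increasing2)
    next
      case False
      then show ?thesis using power_increasing[OF \<open>m \<le> n\<close>, of "cmod (f \<omega>)"] by linarith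
    qed
    then show "norm (cmod (f \<omega>) ^ m) \<le> norm (1 + cmod (f \<omega>) ^ n)" by simp
  qed
qed (use f n in auto)

lemma indep_var_complex_compose:
  fixes X Y :: "'a \<Rightarrow> complex" and f g :: "complex \<Rightarrow> complex"
  assumes "indep_var borel X borel Y" "f \<in> borel_measurable borel" "g \<in> borel_measurable borel"
  shows "indep_var borel (\<lambda>\<omega>. f (X \<omega>)) borel (\<lambda>\<omega>. g (Y \<omega>))"
  using indep_var_compose[OF assms] by (simp add: comp_def)

text \<open>Here \<open>of_real c * X + Z\<close> is a pilot observation, split into the channel \<open>X\<close> of one UE and
  the rest; \<open>c = 0\<close> when that UE uses another pilot.\<close>

lemma
  fixes X Z :: "'a \<Rightarrow> complex" and c :: real
  assumes XZ: "indep_var borel X borel Z"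
    and X2: "has_bochner_integral M (\<lambda>\<omega>. (cmod (X \<omega>))\<^sup>2) x2"
    and X4: "has_bochner_integral M (\<lambda>\<omega>. (cmod (X \<omega>)) ^ 4) x4"
    and X: "has_bochner_integral M X 0"
    and Z: "has_bochner_integral M Z 0"
    and Z2: "has_bochner_integral M (\<lambda>\<omega>. (cmod (Z \<omega>))\<^sup>2) z2"
  shows mean_correlation:
      "has_bochner_integral M (\<lambda>\<omega>. cnj (of_real c * X \<omega> + Z \<omega>) * X \<omega>) (of_real (c * x2))"
    and mean_square_correlation:
      "has_bochner_integral M (\<lambda>\<omega>. (cmod (cnj (of_real c * X \<omega> + Z \<omega>) * X \<omega>))\<^sup>2)
         (c\<^sup>2 * x4 + x2 * z2)"
proof -
  have rv: "X \<in> borel_measurable M" "Z \<in> borel_measurable M"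
    using XZ by (auto simp: indep_var_eq)
  have cX2: "has_bochner_integral M (\<lambda>\<omega>. complex_of_real ((cmod (X \<omega>))\<^sup>2)) (of_real x2)"
    using X2 by (simp only: has_bochner_integral_of_real_iff)
  have cZ2: "has_bochner_integral M (\<lambda>\<omega>. complex_of_real ((cmod (Z \<omega>))\<^sup>2)) (of_real z2)"
    using Z2 by (simp only: has_bochner_integral_of_real_iff)
  have cX4: "has_bochner_integral M (\<lambda>\<omega>. complex_of_real ((cmod (X \<omega>))^4)) (of_real x4)"
    using X4 by (simp only: has_bochner_integral_of_real_iff)
  have "indep_var borel X borel (\<lambda>\<omega>. cnj (Z \<omega>))"
    by (rule indep_var_complex_compose[OF XZ, of "\<lambda>x. x" cnj]) measurable
  from has_bochner_integral_add[OF has_bochner_integral_mult_right[of "of_real c", OF cX2]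
      has_bochner_integral_indep_mult[OF this X has_bochner_integral_cnj[OF Z]]]
  have "has_bochner_integral M (\<lambda>\<omega>. of_real c * of_real ((cmod (X \<omega>))\<^sup>2) + X \<omega> * cnj (Z \<omega>)) (of_real (c * x2))"
    by simp
  moreover have "of_real c * of_real ((cmod (X \<omega>))\<^sup>2) + X \<omega> * cnj (Z \<omega>)
      = cnj (of_real c * X \<omega> + Z \<omega>) * X \<omega>" for \<omega>
    unfolding complex_norm_square by (simp add: algebra_simps)
  ultimately show "has_bochner_integral M (\<lambda>\<omega>. cnj (of_real c * X \<omega> + Z \<omega>) * X \<omega>) (of_real (c * x2))"
    by (simp only:)
  \<comment> \<open>Only the existence of the mixed third moment \<open>x3\<close> matters:
    independence multiplies it by the conjugate of the mean of \<open>Z\<close>, which is 0.\<close>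
  have "integrable M (\<lambda>\<omega>. (cmod (X \<omega>)) ^ 3)"
    using integrable_cmod_mono[OF rv(1), of 4 3] X4 by (simp add: has_bochner_integral_iff)
  then have "integrable M (\<lambda>\<omega>. X \<omega> * of_real ((cmod (X \<omega>))\<^sup>2))"
    by (rule Bochner_Integration.integrable_bound)
       (use rv in \<open>auto simp: norm_mult norm_power power3_eq_cube power2_eq_square\<close>)
  then obtain x3 where X3: "has_bochner_integral M (\<lambda>\<omega>. X \<omega> * of_real ((cmod (X \<omega>))\<^sup>2)) x3"
    by (auto simp: has_bochner_integral_iff)
  have "indep_var borel (\<lambda>\<omega>. X \<omega> * of_real ((cmod (X \<omega>))\<^sup>2)) borel (\<lambda>\<omega>. cnj (Z \<omega>))"
    by (rule indep_var_complex_compose[OF XZ, of "\<lambda>x. x * of_real ((cmod x)\<^sup>2)" cnj]) measurable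
  note cross = has_bochner_integral_indep_mult[OF this X3 has_bochner_integral_cnj[OF Z]]
  have "indep_var borel (\<lambda>\<omega>. complex_of_real ((cmod (X \<omega>))\<^sup>2)) borel (\<lambda>\<omega>. complex_of_real ((cmod (Z \<omega>))\<^sup>2))"
    by (rule indep_var_complex_compose[OF XZ, of "\<lambda>x. of_real ((cmod x)\<^sup>2)" "\<lambda>x. of_real ((cmod x)\<^sup>2)"]) measurable
  note xz = has_bochner_integral_indep_mult[OF this cX2 cZ2]
  \<comment> \<open>Twice the real part of the cross term is written as the term plus its conjugate,
    so that complex linearity applies.\<close>
  have "has_bochner_integral M (\<lambda>\<omega>. of_real (c\<^sup>2) * of_real (cmod (X \<omega>) ^ 4)
      + of_real ((cmod (X \<omega>))\<^sup>2) * of_real ((cmod (Z \<omega>))\<^sup>2)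
      + (of_real c * (X \<omega> * of_real ((cmod (X \<omega>))\<^sup>2) * cnj (Z \<omega>))
         + of_real c * cnj (X \<omega> * of_real ((cmod (X \<omega>))\<^sup>2) * cnj (Z \<omega>))))
      (of_real (c\<^sup>2) * of_real x4 + of_real x2 * of_real z2 + (of_real c * (x3 * cnj 0) + of_real c * cnj (x3 * cnj 0)))"
    by (intro has_bochner_integral_add has_bochner_integral_mult_right xz cX4 cross has_bochner_integral_cnj)
  moreover have "of_real (c\<^sup>2) * of_real (cmod (X \<omega>) ^ 4)
      + of_real ((cmod (X \<omega>))\<^sup>2) * of_real ((cmod (Z \<omega>))\<^sup>2)
      + (of_real c * (X \<omega> * of_real ((cmod (X \<omega>))\<^sup>2) * cnj (Z \<omega>))
         + of_real c * cnj (X \<omega> * of_real ((cmod (X \<omega>))\<^sup>2) * cnj (Z \<omega>)))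
      = of_real ((cmod (cnj (of_real c * X \<omega> + Z \<omega>) * X \<omega>))\<^sup>2)" for \<omega>
  proof -
    have "complex_of_real (cmod (X \<omega>) ^ 4) = of_real ((cmod (X \<omega>))\<^sup>2) * of_real ((cmod (X \<omega>))\<^sup>2)"
      by (simp flip: of_real_mult power_add)
    then show ?thesis
      by (simp only: complex_norm_square) (simp add: algebra_simps power2_eq_square)
  qed
  ultimately have "has_bochner_integral M (\<lambda>\<omega>. complex_of_real ((cmod (cnj (of_real c * X \<omega> + Z \<omega>) * X \<omega>))\<^sup>2))
         (of_real (c\<^sup>2 * x4 + x2 * z2))" by simp
  then show "has_bochner_integral M (\<lambda>\<omega>. (cmod (cnj (of_real c * X \<omega> + Z \<omega>) * X \<omega>))\<^sup>2)
         (c\<^sup>2 * x4 + x2 * z2)"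
    by (simp only: has_bochner_integral_of_real_iff)
qed

end

text \<open>For centred independent terms only the diagonal of the double sum survives. This serves
  both the projection of the noise vector onto a pilot and the pilot observation as a combination of
  noise and channels.\<close>

lemma (in prob_space)
  fixes U :: "'i \<Rightarrow> 'a \<Rightarrow> complex" and a :: "'i \<Rightarrow> complex"
  assumes U: "indep_vars (\<lambda>_. borel) U I" and J: "J \<subseteq> I"
    and mean: "\<And>i. i \<in> J \<Longrightarrow> has_bochner_integral M (U i) 0"
    and sq: "\<And>i. i \<in> J \<Longrightarrow> has_bochner_integral M (\<lambda>\<omega>. (cmod (U i \<omega>))\<^sup>2) (s i)"
  shows weighted_sum_mean: "has_bochner_integral M (\<lambda>\<omega>. \<Sum>i\<in>J. a i * U i \<omega>) 0"
    and weighted_sum_square: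
      "has_bochner_integral M (\<lambda>\<omega>. (cmod (\<Sum>i\<in>J. a i * U i \<omega>))\<^sup>2) (\<Sum>i\<in>J. (cmod (a i))\<^sup>2 * s i)"
proof -
  have m: "has_bochner_integral M (\<lambda>\<omega>. a i * U i \<omega>) 0" if "i \<in> J" for i
    using has_bochner_integral_mult_right[of "a i", OF mean[OF that]] by simp
  show "has_bochner_integral M (\<lambda>\<omega>. \<Sum>i\<in>J. a i * U i \<omega>) 0"
    using has_bochner_integral_sum[of J M "\<lambda>i \<omega>. a i * U i \<omega>" "\<lambda>_. 0", OF m] by simp
  have "indep_var borel (\<lambda>\<omega>. a i * U i \<omega>) borel (\<lambda>\<omega>. a j * U j \<omega>)" if "i \<in> J" "j \<in> J" "i \<noteq> j" for i j
    using that J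
    by (intro indep_var_complex_compose[OF indep_vars_imp_indep_var[OF U], of i j "\<lambda>x. a i * x" "\<lambda>x. a j * x"]) auto
  moreover have "has_bochner_integral M (\<lambda>\<omega>. (cmod (a i * U i \<omega>))\<^sup>2) ((cmod (a i))\<^sup>2 * s i)" if "i \<in> J" for i
    using has_bochner_integral_mult_right[of "(cmod (a i))\<^sup>2", OF sq[OF that]]
    by (simp add: norm_mult power_mult_distrib)
  ultimately show "has_bochner_integral M (\<lambda>\<omega>. (cmod (\<Sum>i\<in>J. a i * U i \<omega>))\<^sup>2) (\<Sum>i\<in>J. (cmod (a i))\<^sup>2 * s i)"
    using has_bochner_integral_cmod_sum_square[of J "\<lambda>i \<omega>. a i * U i \<omega>" "\<lambda>_. 0"] m by simp
qed

section \<open>Moments of Rician fading\<close>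

context prob_space
begin

lemma
  assumes X: "distributed M lborel X (normal_density 0 \<sigma>)" and \<sigma>: "0 < \<sigma>"
  shows normal_moment_1: "has_bochner_integral M X 0"
    and normal_moment_2: "has_bochner_integral M (\<lambda>\<omega>. (X \<omega>)\<^sup>2) (\<sigma>\<^sup>2)"
    and normal_moment_4: "has_bochner_integral M (\<lambda>\<omega>. (X \<omega>) ^ 4) (3 * \<sigma> ^ 4)"
proof -
  \<comment> \<open>Moments of \<open>X\<close> are integrals against its density, whose values are
    known; exponents 1, 2 and 4 are the odd case at 0 and the even case at 1 and 2.\<close>
  have *: "has_bochner_integral M (\<lambda>\<omega>. (X \<omega>) ^ n) c"
    if "has_bochner_integral lborel (\<lambda>x. normal_density 0 \<sigma> x * (x - 0) ^ n) c" for n c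
    using that distributed_integrable[OF X, of "\<lambda>x. x ^ n"] distributed_integral[OF X, of "\<lambda>x. x ^ n"]
    by (simp add: has_bochner_integral_iff)
  show "has_bochner_integral M X 0"
    using *[OF normal_moment_odd[OF \<sigma>, of 0 0]] by simp
  show "has_bochner_integral M (\<lambda>\<omega>. (X \<omega>)\<^sup>2) (\<sigma>\<^sup>2)"
    using *[OF normal_moment_even[OF \<sigma>, of 0 1]] by (simp add: fact_2)
  show "has_bochner_integral M (\<lambda>\<omega>. (X \<omega>) ^ 4) (3 * \<sigma> ^ 4)"
    using *[OF normal_moment_even[OF \<sigma>, of 0 2]]
    by (simp add: fact_numeral power_divide flip: power_mult)
qed

text \<open>With independent parts of variance v/2, the mean of \<open>Z\<close> squared is the
  difference of two equal variances plus a multiple of a product of zero means. The fourth moment is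
  3v^2/4 from each part and 2(v/2)^2 from the mixed term.\<close>

lemma
  assumes Z: "complex_normal M Z v" and v: "0 < v"
  shows complex_normal_mean: "has_bochner_integral M Z 0"
    and complex_normal_square: "has_bochner_integral M (\<lambda>\<omega>. (Z \<omega>)\<^sup>2) 0"
    and complex_normal_cmod_2: "has_bochner_integral M (\<lambda>\<omega>. (cmod (Z \<omega>))\<^sup>2) v"
    and complex_normal_cmod_4: "has_bochner_integral M (\<lambda>\<omega>. (cmod (Z \<omega>)) ^ 4) (2 * v\<^sup>2)"
proof -
  define \<sigma> where "\<sigma> = sqrt (v / 2)"
  have \<sigma>: "0 < \<sigma>" "\<sigma>\<^sup>2 = v / 2" "\<sigma> ^ 4 = v\<^sup>2 / 4"
  proof -
    show "\<sigma>\<^sup>2 = v / 2" using v by (simp add: \<sigma>_def)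
    then have "(\<sigma>\<^sup>2)\<^sup>2 = (v / 2)\<^sup>2" by (simp only:)
    then show "\<sigma> ^ 4 = v\<^sup>2 / 4" by (simp add: power_divide)
  qed (use v in \<open>simp add: \<sigma>_def\<close>)
  let ?X = "\<lambda>\<omega>. Re (Z \<omega>)" and ?Y = "\<lambda>\<omega>. Im (Z \<omega>)"
  have indep: "indep_var borel ?X borel ?Y"
    and X: "distributed M lborel ?X (normal_density 0 \<sigma>)"
    and Y: "distributed M lborel ?Y (normal_density 0 \<sigma>)"
    using Z by (auto simp: complex_normal_def \<sigma>_def)
  note X1 = normal_moment_1[OF X \<sigma>(1)] and Y1 = normal_moment_1[OF Y \<sigma>(1)]
  note X2 = normal_moment_2[OF X \<sigma>(1)] and Y2 = normal_moment_2[OF Y \<sigma>(1)]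
  note X4 = normal_moment_4[OF X \<sigma>(1)] and Y4 = normal_moment_4[OF Y \<sigma>(1)]
  note XY = has_bochner_integral_indep_mult[OF indep X1 Y1]
  have "indep_var borel (\<lambda>\<omega>. (?X \<omega>)\<^sup>2) borel (\<lambda>\<omega>. (?Y \<omega>)\<^sup>2)"
    using indep_var_compose[OF indep, of "\<lambda>x. x\<^sup>2" borel "\<lambda>x. x\<^sup>2" borel] by (simp add: comp_def)
  note X2Y2 = has_bochner_integral_indep_mult[OF this X2 Y2]
  have "has_bochner_integral M (\<lambda>\<omega>. of_real (?X \<omega>) + \<i> * of_real (?Y \<omega>)) (of_real 0 + \<i> * of_real 0)"
    by (intro has_bochner_integral_add has_bochner_integral_mult_right
        X1[folded has_bochner_integral_of_real_iff] Y1[folded has_bochner_integral_of_real_iff])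
  then show "has_bochner_integral M Z 0"
    by (simp flip: complex_eq)
  have "has_bochner_integral M (\<lambda>\<omega>. of_real ((?X \<omega>)\<^sup>2 - (?Y \<omega>)\<^sup>2) + 2 * \<i> * of_real (?X \<omega> * ?Y \<omega>))
      (of_real (\<sigma>\<^sup>2 - \<sigma>\<^sup>2) + 2 * \<i> * of_real (0 * 0))"
    by (intro has_bochner_integral_add has_bochner_integral_mult_right
        has_bochner_integral_diff[OF X2 Y2, folded has_bochner_integral_of_real_iff]
        XY[folded has_bochner_integral_of_real_iff])
  moreover have "of_real ((?X \<omega>)\<^sup>2 - (?Y \<omega>)\<^sup>2) + 2 * \<i> * of_real (?X \<omega> * ?Y \<omega>) = (Z \<omega>)\<^sup>2" for \<omega>
    by (simp add: complex_eq_iff power2_eq_square)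
  ultimately show "has_bochner_integral M (\<lambda>\<omega>. (Z \<omega>)\<^sup>2) 0" by simp
  have "has_bochner_integral M (\<lambda>\<omega>. (?X \<omega>)\<^sup>2 + (?Y \<omega>)\<^sup>2) (\<sigma>\<^sup>2 + \<sigma>\<^sup>2)"
    by (intro has_bochner_integral_add X2 Y2)
  then show "has_bochner_integral M (\<lambda>\<omega>. (cmod (Z \<omega>))\<^sup>2) v"
    by (simp add: cmod_power2 \<sigma>(2))
  have "has_bochner_integral M (\<lambda>\<omega>. (?X \<omega>)^4 + (?Y \<omega>)^4 + 2 * ((?X \<omega>)\<^sup>2 * (?Y \<omega>)\<^sup>2))
     (3 * \<sigma>^4 + 3 * \<sigma>^4 + 2 * (\<sigma>\<^sup>2 * \<sigma>\<^sup>2))"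
    by (intro has_bochner_integral_add has_bochner_integral_mult_right X4 Y4 X2Y2)
  moreover have "(?X \<omega>)^4 + (?Y \<omega>)^4 + 2 * ((?X \<omega>)\<^sup>2 * (?Y \<omega>)\<^sup>2) = cmod (Z \<omega>) ^ 4" for \<omega>
  proof -
    have "cmod (Z \<omega>) ^ 4 = ((cmod (Z \<omega>))\<^sup>2)\<^sup>2" by simp
    then show ?thesis unfolding cmod_power2 by (simp add: power2_sum)
  qed
  moreover have "3 * \<sigma>^4 + 3 * \<sigma>^4 + 2 * (\<sigma>\<^sup>2 * \<sigma>\<^sup>2) = 2 * v\<^sup>2"
    unfolding \<sigma> by (simp add: power2_eq_square)
  ultimately show "has_bochner_integral M (\<lambda>\<omega>. (cmod (Z \<omega>)) ^ 4) (2 * v\<^sup>2)" by (simp only:)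
qed

text \<open>The density is constant on a full period, over which cosine and sine both integrate to
  0.\<close>

lemma has_bochner_integral_cis_uniform:
  assumes X: "distributed M lborel X (\<lambda>x. indicator {-pi..pi} x / measure lborel {-pi..pi})"
  shows "has_bochner_integral M (\<lambda>\<omega>. cis (X \<omega>)) 0"
proof -
  have *: "has_bochner_integral M (\<lambda>\<omega>. f (X \<omega>)) 0"
    if f: "has_bochner_integral lborel (\<lambda>x. f x * indicator {-pi..pi} x) 0"
      "f \<in> borel_measurable borel" for f :: "real \<Rightarrow> real"
  proof -
    have "has_bochner_integral lborel (\<lambda>x. (f x * indicator {-pi..pi} x) / (2 * pi)) (0 / (2 * pi))"
      by (intro has_bochner_integral_divide f)
    then have "has_bochner_integral lborel (\<lambda>x. indicator {-pi..pi} x / measure lborel {-pi..pi} * f x) 0"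
      by (simp add: mult.commute)
    then show ?thesis
      using distributed_integrable[OF X, of f] distributed_integral[OF X, of f] f(2)
      by (simp add: has_bochner_integral_iff)
  qed
  have "has_bochner_integral lborel (\<lambda>x. cos x * indicator {-pi..pi} x) (sin pi - sin (-pi))"
    by (rule has_bochner_integral_FTC_Icc_real) (auto intro!: derivative_eq_intros)
  then have c: "has_bochner_integral M (\<lambda>\<omega>. cos (X \<omega>)) 0"
    by (intro *) auto
  have "has_bochner_integral lborel (\<lambda>x. sin x * indicator {-pi..pi} x) (- cos pi - - cos (-pi))"
    by (rule has_bochner_integral_FTC_Icc_real) (auto intro!: derivative_eq_intros)
  then have s: "has_bochner_integral M (\<lambda>\<omega>. sin (X \<omega>)) 0"
    by (intro *) auto
  have "has_bochner_integral M (\<lambda>\<omega>. of_real (cos (X \<omega>)) + \<i> * of_real (sin (X \<omega>))) (of_real 0 + \<i> * of_real 0)"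
    by (intro has_bochner_integral_add has_bochner_integral_mult_right
        c[folded has_bochner_integral_of_real_iff] s[folded has_bochner_integral_of_real_iff])
  then show ?thesis
    by (simp add: cis_conv_exp exp_Euler flip: cos_of_real sin_of_real)
qed

text \<open>The squared modulus of \<open>h\<close> is a^2 + |g|^2 + 2a Re C. On squaring it, every
  term that depends on the phase reduces to the real part of C, of C^2 or of C|g|^2, and each of
  these has mean 0.\<close>

lemma
  fixes U g :: "'a \<Rightarrow> complex" and a v :: real
  assumes Ug: "indep_var borel U borel g"
    and U: "has_bochner_integral M U 0" and norm_U: "\<And>\<omega>. cmod (U \<omega>) = 1"
    and g: "complex_normal M g v" and v: "0 < v"
  defines "h \<equiv> \<lambda>\<omega>. of_real a * U \<omega> + g \<omega>"
  shows rician_mean: "has_bochner_integral M h 0"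
    and rician_cmod_2: "has_bochner_integral M (\<lambda>\<omega>. (cmod (h \<omega>))\<^sup>2) (v + a\<^sup>2)"
    and rician_cmod_4: "has_bochner_integral M (\<lambda>\<omega>. (cmod (h \<omega>)) ^ 4)
           ((v + a\<^sup>2)\<^sup>2 + v\<^sup>2 + 2 * a\<^sup>2 * v)"
proof -
  note g1 = complex_normal_mean[OF g v] and gsq = complex_normal_square[OF g v]
    and g2 = complex_normal_cmod_2[OF g v] and g4 = complex_normal_cmod_4[OF g v]
  have rv: "U \<in> borel_measurable M" "g \<in> borel_measurable M"
    using Ug by (auto simp: indep_var_eq)
  show "has_bochner_integral M h 0"
    using has_bochner_integral_add[OF has_bochner_integral_mult_right[of "of_real a", OF U] g1]
    by (simp add: h_def)
  define C where "C \<omega> = cnj (U \<omega>) * g \<omega>" for \<omega>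
  have cU: "has_bochner_integral M (\<lambda>\<omega>. cnj (U \<omega>)) 0"
    using has_bochner_integral_cnj[OF U] by simp
  have "indep_var borel (\<lambda>\<omega>. cnj (U \<omega>)) borel g"
    by (rule indep_var_complex_compose[OF Ug, of cnj "\<lambda>x. x"]) measurable
  from has_bochner_integral_indep_mult[OF this cU g1]
  have C1: "has_bochner_integral M C 0" by (simp add: C_def[abs_def])
  \<comment> \<open>Boundedness gives the mean \<open>u\<close> of the squared conjugate phase
    factor; in the mean of C^2 it is multiplied by the mean of g^2, which is 0 by circular
    symmetry.\<close>
  have "integrable M (\<lambda>\<omega>. (cnj (U \<omega>))\<^sup>2)"
    by (rule integrable_const_bound[of _ 1]) (use rv in \<open>auto simp: norm_power norm_U\<close>)
  then obtain u where "has_bochner_integral M (\<lambda>\<omega>. (cnj (U \<omega>))\<^sup>2) u"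
    by (auto simp: has_bochner_integral_iff)
  moreover have "indep_var borel (\<lambda>\<omega>. (cnj (U \<omega>))\<^sup>2) borel (\<lambda>\<omega>. (g \<omega>)\<^sup>2)"
    by (rule indep_var_complex_compose[OF Ug, of "\<lambda>x. (cnj x)\<^sup>2" "\<lambda>x. x\<^sup>2"]) measurable
  ultimately have C2: "has_bochner_integral M (\<lambda>\<omega>. (C \<omega>)\<^sup>2) 0"
    using has_bochner_integral_indep_mult[OF _ _ gsq] by (fastforce simp: C_def power_mult_distrib)
  \<comment> \<open>Here the factor with mean 0 is the conjugate of \<open>U\<close>, so
    \<open>g3\<close> only has to exist.\<close>
  have "integrable M (\<lambda>\<omega>. (cmod (g \<omega>)) ^ 3)"
    using integrable_cmod_mono[OF rv(2), of 4 3] g4 by (simp add: has_bochner_integral_iff)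
  then have "integrable M (\<lambda>\<omega>. g \<omega> * of_real ((cmod (g \<omega>))\<^sup>2))"
    by (rule Bochner_Integration.integrable_bound)
       (use rv in \<open>auto simp: norm_mult norm_power power3_eq_cube power2_eq_square\<close>)
  then obtain g3 where "has_bochner_integral M (\<lambda>\<omega>. g \<omega> * of_real ((cmod (g \<omega>))\<^sup>2)) g3"
    by (auto simp: has_bochner_integral_iff)
  moreover have "indep_var borel (\<lambda>\<omega>. cnj (U \<omega>)) borel (\<lambda>\<omega>. g \<omega> * of_real ((cmod (g \<omega>))\<^sup>2))"
    by (rule indep_var_complex_compose[OF Ug, of cnj "\<lambda>x. x * of_real ((cmod x)\<^sup>2)"]) measurable
  ultimately have "has_bochner_integral M (\<lambda>\<omega>. cnj (U \<omega>) * (g \<omega> * of_real ((cmod (g \<omega>))\<^sup>2))) (0 * g3)"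
    using has_bochner_integral_indep_mult[OF _ cU] by blast
  then have C3: "has_bochner_integral M (\<lambda>\<omega>. C \<omega> * of_real ((cmod (g \<omega>))\<^sup>2)) 0"
    by (simp add: C_def mult.assoc)
  note Re = has_bochner_integral_bounded_linear[OF bounded_linear_Re]
  have h2: "(cmod (h \<omega>))\<^sup>2 = a\<^sup>2 + (cmod (g \<omega>))\<^sup>2 + 2 * a * Re (C \<omega>)" for \<omega>
  proof -
    have "(Re (U \<omega>))\<^sup>2 + (Im (U \<omega>))\<^sup>2 = 1" using norm_U[of \<omega>] by (simp flip: cmod_power2)
    then have "a\<^sup>2 = a\<^sup>2 * ((Re (U \<omega>))\<^sup>2 + (Im (U \<omega>))\<^sup>2)" by simp
    then show ?thesis
      unfolding cmod_power2 h_def C_def by (simp add: algebra_simps power2_eq_square)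
  qed
  have "has_bochner_integral M (\<lambda>\<omega>. a\<^sup>2 + (cmod (g \<omega>))\<^sup>2 + 2 * a * Re (C \<omega>)) (a\<^sup>2 + v + 2 * a * Re 0)"
    using prob_space by (intro has_bochner_integral_add has_bochner_integral_mult_right Re[OF C1] g2)
      (auto simp: has_bochner_integral_iff)
  then show "has_bochner_integral M (\<lambda>\<omega>. (cmod (h \<omega>))\<^sup>2) (v + a\<^sup>2)"
    by (simp add: h2 add.commute)
  have h4: "(cmod (h \<omega>)) ^ 4 = a ^ 4 + (cmod (g \<omega>)) ^ 4 + 4 * a\<^sup>2 * (cmod (g \<omega>))\<^sup>2
      + (2 * a\<^sup>2 * Re ((C \<omega>)\<^sup>2) + 4 * a ^ 3 * Re (C \<omega>) + 4 * a * Re (C \<omega> * of_real ((cmod (g \<omega>))\<^sup>2)))" for \<omega>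
  proof -
    have "cmod (C \<omega>) = cmod (g \<omega>)" by (simp add: C_def norm_mult norm_U)
    then have "(cmod (g \<omega>))\<^sup>2 = (Re (C \<omega>))\<^sup>2 + (Im (C \<omega>))\<^sup>2" by (simp flip: cmod_power2)
    then have R: "2 * (Re (C \<omega>))\<^sup>2 = (cmod (g \<omega>))\<^sup>2 + Re ((C \<omega>)\<^sup>2)"
      by (simp add: power2_eq_square)
    have "(cmod (h \<omega>)) ^ 4 = (a\<^sup>2 + (cmod (g \<omega>))\<^sup>2 + 2 * a * Re (C \<omega>))\<^sup>2"
      unfolding h2[symmetric] by simp
    also have "\<dots> = a ^ 4 + (cmod (g \<omega>)) ^ 4 + 2 * a\<^sup>2 * (cmod (g \<omega>))\<^sup>2 + 2 * a\<^sup>2 * (2 * (Re (C \<omega>))\<^sup>2)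
        + 4 * a ^ 3 * Re (C \<omega>) + 4 * a * Re (C \<omega>) * (cmod (g \<omega>))\<^sup>2"
      by (simp add: power2_eq_square power3_eq_cube power4_eq_xxxx algebra_simps)
    finally show ?thesis
      unfolding R by (simp add: algebra_simps)
  qed
  have "has_bochner_integral M (\<lambda>\<omega>. a ^ 4 + (cmod (g \<omega>)) ^ 4 + 4 * a\<^sup>2 * (cmod (g \<omega>))\<^sup>2
      + (2 * a\<^sup>2 * Re ((C \<omega>)\<^sup>2) + 4 * a ^ 3 * Re (C \<omega>) + 4 * a * Re (C \<omega> * of_real ((cmod (g \<omega>))\<^sup>2))))
     (a ^ 4 + 2 * v\<^sup>2 + 4 * a\<^sup>2 * v + (2 * a\<^sup>2 * Re 0 + 4 * a ^ 3 * Re 0 + 4 * a * Re 0))"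
    using prob_space
    by (intro has_bochner_integral_add has_bochner_integral_mult_right Re[OF C1] Re[OF C2] Re[OF C3] g2 g4)
      (auto simp: has_bochner_integral_iff)
  moreover have "a ^ 4 + 2 * v\<^sup>2 + 4 * a\<^sup>2 * v = (v + a\<^sup>2)\<^sup>2 + v\<^sup>2 + 2 * a\<^sup>2 * v"
    by (simp add: power2_eq_square power4_eq_xxxx algebra_simps)
  ultimately show "has_bochner_integral M (\<lambda>\<omega>. (cmod (h \<omega>)) ^ 4) ((v + a\<^sup>2)\<^sup>2 + v\<^sup>2 + 2 * a\<^sup>2 * v)"
    by (simp add: h4)
qed

end

lemma borel_measurable_herm [measurable]: "herm x \<in> borel_measurable borel"
  unfolding herm_def by (intro borel_measurable_continuous_onI continuous_intros)

section \<open>Pilot observations and channels\<close>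

context cell_free
begin

text \<open>The projection weighs independent noise entries by conjugated pilot entries, so the
  variance is scaled by the squared norm \<open>tau_p S\<close> of the pilot.\<close>

lemma
  shows pilot_noise_mean:
      "has_bochner_integral (pspace S) (\<lambda>\<omega>. herm (pilot S t) (ul_noise S m \<omega>)) 0"
    and pilot_noise_square:
      "has_bochner_integral (pspace S) (\<lambda>\<omega>. (cmod (herm (pilot S t) (ul_noise S m \<omega>)))\<^sup>2)
         (tau_p S * ul_var S)"
proof -
  have indep: "indep_vars (\<lambda>_. borel) (\<lambda>i \<omega>. ul_noise S m \<omega> $ i) UNIV"
    and n: "complex_normal (pspace S) (\<lambda>\<omega>. ul_noise S m \<omega> $ i) (ul_var S)" for i
    using ul_noise_normal[of m] by (auto simp: complex_normal_vec_def)
  note n1 = complex_normal_mean[OF n ul_var_pos] and n2 = complex_normal_cmod_2[OF n ul_var_pos]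
  show "has_bochner_integral (pspace S) (\<lambda>\<omega>. herm (pilot S t) (ul_noise S m \<omega>)) 0"
    unfolding herm_def by (rule weighted_sum_mean[OF indep _ n1 n2]) auto
  have "(\<Sum>i\<in>UNIV. (cmod (cnj (pilot S t $ i)))\<^sup>2 * ul_var S) = tau_p S * ul_var S"
    using pilot_norm[of t] by (simp add: norm_vec_def L2_set_def sum_nonneg flip: sum_distrib_right)
  then show "has_bochner_integral (pspace S) (\<lambda>\<omega>. (cmod (herm (pilot S t) (ul_noise S m \<omega>)))\<^sup>2)
         (tau_p S * ul_var S)"
    using weighted_sum_square[OF indep _ n1 n2, of UNIV "\<lambda>i. cnj (pilot S t $ i)"]
    unfolding herm_def by simp
qed

lemma borel_measurable_cis_Re [measurable]: "(\<lambda>z. cis (Re z)) \<in> borel_measurable borel"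
  by (intro borel_measurable_continuous_onI continuous_intros)

text \<open>These are the Rician moments with \<open>U\<close> the phase factor and \<open>g\<close>
  the scattered part. Writing the fourth moment as a square plus an excess isolates what becomes the
  trace of D(R^2 + 2LR).\<close>

lemma
  shows chan_mean: "has_bochner_integral (pspace S) (chan S m k) 0"
    and chan_cmod_2: "has_bochner_integral (pspace S) (\<lambda>\<omega>. (cmod (chan S m k \<omega>))\<^sup>2) (beta' S m k)"
    and chan_cmod_4: "has_bochner_integral (pspace S) (\<lambda>\<omega>. (cmod (chan S m k \<omega>)) ^ 4)
           ((beta' S m k)\<^sup>2 + ((beta S m k)\<^sup>2 + 2 * (hbar S m k)\<^sup>2 * beta S m k))"
proof -
  \<comment> \<open>In the joint family the phase is embedded into the complex numbers;
    \<open>Re\<close> recovers it when the phase factor is formed.\<close>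
  have "indep_var borel (\<lambda>\<omega>. complex_of_real (phase S m k \<omega>)) borel (scatter S m k)"
    using indep_vars_imp_indep_var[OF phase_scatter_indep, of "Inl (m, k)" "Inr (m, k)"] by simp
  from indep_var_complex_compose[OF this borel_measurable_cis_Re, of "\<lambda>x. x"]
  have "indep_var borel (\<lambda>\<omega>. cis (phase S m k \<omega>)) borel (scatter S m k)" by simp
  note rice = this has_bochner_integral_cis_uniform[OF phase_uniform] norm_cis scatter_normal beta_pos
  show "has_bochner_integral (pspace S) (chan S m k) 0"
    using rician_mean[OF rice] by (simp add: chan_def[abs_def])
  show "has_bochner_integral (pspace S) (\<lambda>\<omega>. (cmod (chan S m k \<omega>))\<^sup>2) (beta' S m k)"
    using rician_cmod_2[OF rice] by (simp add: chan_def[abs_def] beta'_def)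
  show "has_bochner_integral (pspace S) (\<lambda>\<omega>. (cmod (chan S m k \<omega>)) ^ 4)
           ((beta' S m k)\<^sup>2 + ((beta S m k)\<^sup>2 + 2 * (hbar S m k)\<^sup>2 * beta S m k))"
    using rician_cmod_4[OF rice] by (simp add: chan_def[abs_def] beta'_def add.assoc)
qed

text \<open>Each channel is a function of its own phase and scattered part, and these pairs are
  disjoint blocks of the joint family.\<close>

lemma chan_indep: "indep_vars (\<lambda>_. borel) (\<lambda>(m, k). chan S m k) UNIV"
proof (rule indep_vars_group[OF phase_scatter_indep])
  show "disjoint_family_on (\<lambda>p. {Inl p, Inr p}) UNIV"
    by (auto simp: disjoint_family_on_def)
  fix p :: "'m \<times> 'k"
  show "(\<lambda>v. of_real (case p of (m, k) \<Rightarrow> hbar S m k) * cis (Re (v (Inl p))) + v (Inr p))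
      \<in> borel_measurable (PiM {Inl p, Inr p} (\<lambda>_. borel))"
    by (intro borel_measurable_add borel_measurable_times measurable_compose[OF _ borel_measurable_cis_Re])
      (auto intro: measurable_component_singleton)
qed (auto simp: chan_def)

text \<open>Projecting the vector noise onto one pilot makes it scalar, so that noise and channels
  fit into a single complex family containing all the randomness in the observations of that
  pilot.\<close>

definition source :: "'t \<Rightarrow> 'm + 'm \<times> 'k \<Rightarrow> 'w \<Rightarrow> complex" where
  "source t = case_sum (\<lambda>m \<omega>. herm (pilot S t) (ul_noise S m \<omega>)) (\<lambda>(m, k). chan S m k)"

text \<open>Projected noises and single channels are measurable with respect to the sigma-algebras
  generated by the whole noise and channel families, which are independent by assumption.\<close>

lemma source_indep: "indep_vars (\<lambda>_. borel) (source t) UNIV"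
  unfolding source_def
proof (rule indep_vars_case_sum[OF _ chan_indep ul_noise_chan_indep])
  show "indep_vars (\<lambda>_. borel) (\<lambda>m \<omega>. herm (pilot S t) (ul_noise S m \<omega>)) UNIV"
    by (rule indep_vars_compose2[OF ul_noise_indep]) measurable
  have "(\<lambda>\<omega>. (\<lambda>m. ul_noise S m \<omega>) m) \<in> measurable (vimage_algebra (space (pspace S))
      (\<lambda>\<omega> m. ul_noise S m \<omega>) (PiM UNIV (\<lambda>_. borel))) borel" for m
    by (rule measurable_compose[OF measurable_vimage_algebra1 measurable_component_singleton])
      (auto simp: space_PiM)
  from measurable_compose[OF this borel_measurable_herm]
  show "(\<lambda>\<omega>. herm (pilot S t) (ul_noise S m \<omega>)) \<in> borel_measurable (vimage_algebra (space (pspace S))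
      (\<lambda>\<omega> m. ul_noise S m \<omega>) (PiM UNIV (\<lambda>_. borel)))" for m by simp
  have "(\<lambda>\<omega>. (\<lambda>(m, k). chan S m k \<omega>) p) \<in> borel_measurable (vimage_algebra (space (pspace S))
      (\<lambda>\<omega> (m, k). chan S m k \<omega>) (PiM UNIV (\<lambda>_. borel)))" for p :: "'m \<times> 'k"
    by (rule measurable_compose[OF measurable_vimage_algebra1 measurable_component_singleton])
      (auto simp: space_PiM)
  moreover have "(\<lambda>\<omega>. (\<lambda>(m, k). chan S m k \<omega>) p) = (case p of (m, k) \<Rightarrow> chan S m k)" for p :: "'m \<times> 'k"
    by (cases p) simp
  ultimately show "(case p of (m, k) \<Rightarrow> chan S m k) \<in> borel_measurable (vimage_algebra (space (pspace S))
      (\<lambda>\<omega> (m, k). chan S m k \<omega>) (PiM UNIV (\<lambda>_. borel)))" for p :: "'m \<times> 'k"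
    by metis
qed simp_all

lemma source_mean: "has_bochner_integral (pspace S) (source t i) 0"
  by (auto simp: source_def pilot_noise_mean chan_mean split: sum.split prod.split)

lemma source_square: "has_bochner_integral (pspace S) (\<lambda>\<omega>. (cmod (source t i \<omega>))\<^sup>2)
    (case i of Inl m \<Rightarrow> tau_p S * ul_var S | Inr (m, k) \<Rightarrow> beta' S m k)"
  by (auto simp: source_def pilot_noise_square chan_cmod_2 split: sum.split prod.split)

text \<open>The coefficient of the channel of UE \<open>k\<close> in the observation used for UE
  \<open>l\<close>. Extension by 0 lets sums run over all UEs and treats shared and different pilots
  alike.\<close>

definition gain :: "'k \<Rightarrow> 'k \<Rightarrow> real" where
  "gain l k = (if k \<in> copilot S l then sqrt (ppow S k) * tau_p S else 0)"

lemma gain_square: "(gain l k)\<^sup>2 = (if k \<in> copilot S l then ppow S k * (tau_p S)\<^sup>2 else 0)"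
  using ppow_pos[of k] by (simp add: gain_def power_mult_distrib)

lemma pilot_obs_eq:
  "pilot_obs S m l \<omega> = (\<Sum>i\<in>UNIV. of_real (gain l i) * chan S m i \<omega>)
     + herm (pilot S (pilot_of S l)) (ul_noise S m \<omega>)"
  by (simp add: pilot_obs_def gain_def sum.If_cases if_distrib[of of_real] if_distrib[of "\<lambda>x. x * _"] cong: if_cong)

text \<open>The right side is the mean power of an observation. Squared gains carry two factors
  \<open>tau_p S\<close> and \<open>lambda'\<close> only one, hence the factor on the left.\<close>

lemma lambda'_eq: "tau_p S * lambda' S m l = (\<Sum>i\<in>UNIV. (gain l i)\<^sup>2 * beta' S m i) + tau_p S * ul_var S"
proof -
  have "(\<Sum>i\<in>UNIV. (gain l i)\<^sup>2 * beta' S m i) = (\<Sum>i\<in>copilot S l. tau_p S * (ppow S i * tau_p S * beta' S m i))"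
    by (rule sum.mono_neutral_cong_right) (simp_all add: gain_square, simp add: power2_eq_square)
  then show ?thesis
    by (simp add: lambda'_def distrib_left sum_distrib_left)
qed

text \<open>Taking all UEs for \<open>A\<close> gives the pilot observation; leaving out
  \<open>k\<close> gives the remainder independent of the channel of \<open>k\<close>.\<close>

lemma
  fixes m :: 'm and l :: 'k
  defines "obs \<equiv> \<lambda>A \<omega>. (\<Sum>i\<in>A. of_real (gain l i) * chan S m i \<omega>)
     + herm (pilot S (pilot_of S l)) (ul_noise S m \<omega>)"
  shows partial_obs_mean: "has_bochner_integral (pspace S) (obs A) 0"
    and partial_obs_square: "has_bochner_integral (pspace S) (\<lambda>\<omega>. (cmod (obs A \<omega>))\<^sup>2)
          ((\<Sum>i\<in>A. (gain l i)\<^sup>2 * beta' S m i) + tau_p S * ul_var S)"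
    and partial_obs_indep: "k \<notin> A \<Longrightarrow> indep_var borel (chan S m k) borel (obs A)"
proof -
  \<comment> \<open>\<open>B\<close> collects the sources occurring in \<open>obs A\<close>; the
    channel of \<open>k\<close> at this AP lies outside it when \<open>k\<close> is not in
    \<open>A\<close>, so the two are functions of disjoint blocks.\<close>
  define B :: "('m + 'm \<times> 'k) set" where "B = insert (Inl m) ((\<lambda>i. Inr (m, i)) ` A)"
  define a where "a = case_sum (\<lambda>_ :: 'm. 1) (\<lambda>(m :: 'm, i). complex_of_real (gain l i))"
  have sum_B: "(\<Sum>j\<in>B. f j) = (\<Sum>i\<in>A. f (Inr (m, i))) + f (Inl m)"
    for f :: "'m + 'm \<times> 'k \<Rightarrow> 'z :: comm_monoid_add"
    unfolding B_def by (subst sum.insert) (auto simp: sum.reindex inj_on_def add.commute)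
  have obs_eq: "obs A = (\<lambda>\<omega>. \<Sum>j\<in>B. a j * source (pilot_of S l) j \<omega>)"
    by (simp add: obs_def sum_B a_def source_def)
  show "has_bochner_integral (pspace S) (obs A) 0"
    unfolding obs_eq by (rule weighted_sum_mean[OF source_indep _ source_mean source_square]) auto
  have "has_bochner_integral (pspace S) (\<lambda>\<omega>. (cmod (obs A \<omega>))\<^sup>2)
     (\<Sum>j\<in>B. (cmod (a j))\<^sup>2 * (case j of Inl m \<Rightarrow> tau_p S * ul_var S | Inr (m, k) \<Rightarrow> beta' S m k))"
    unfolding obs_eq by (rule weighted_sum_square[OF source_indep _ source_mean source_square]) auto
  then show "has_bochner_integral (pspace S) (\<lambda>\<omega>. (cmod (obs A \<omega>))\<^sup>2)
          ((\<Sum>i\<in>A. (gain l i)\<^sup>2 * beta' S m i) + tau_p S * ul_var S)"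
    by (simp add: sum_B a_def)
  assume "k \<notin> A"
  then have disj: "{Inr (m, k)} \<inter> B = {}" by (auto simp: B_def)
  have "(\<lambda>v. v (Inr (m, k))) \<in> measurable (PiM {Inr (m, k)} (\<lambda>_. borel)) (borel :: complex measure)"
    by (rule measurable_component_singleton) simp
  moreover have "(\<lambda>v. \<Sum>j\<in>B. a j * v j) \<in> measurable (PiM B (\<lambda>_. borel)) (borel :: complex measure)"
    by (intro borel_measurable_sum borel_measurable_times borel_measurable_const measurable_component_singleton)
  ultimately show "indep_var borel (chan S m k) borel (obs A)"
    using indep_var_group[OF source_indep disj, of "\<lambda>v. v (Inr (m, k))" borel "\<lambda>v. \<Sum>j\<in>B. a j * v j" borel "pilot_of S l"]
    unfolding obs_eq by (simp add: source_def)
qed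

section \<open>Correlation of pilot observations with channels\<close>

lemma pilot_obs_square:
  "has_bochner_integral (pspace S) (\<lambda>\<omega>. (cmod (pilot_obs S m l \<omega>))\<^sup>2) (tau_p S * lambda' S m l)"
  using partial_obs_square[where A = UNIV and l = l and m = m] by (simp add: pilot_obs_eq lambda'_eq)

lemma
  shows obs_chan_mean: "has_bochner_integral (pspace S)
      (\<lambda>\<omega>. cnj (pilot_obs S m l \<omega>) * chan S m k \<omega>) (of_real (gain l k * beta' S m k))"
    and obs_chan_square: "has_bochner_integral (pspace S)
      (\<lambda>\<omega>. (cmod (cnj (pilot_obs S m l \<omega>) * chan S m k \<omega>))\<^sup>2)
      (tau_p S * lambda' S m l * beta' S m k
        + (gain l k)\<^sup>2 * ((beta S m k)\<^sup>2 + 2 * (hbar S m k)\<^sup>2 * beta S m k))"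
proof -
  define Z where "Z \<omega> = (\<Sum>i\<in>UNIV - {k}. of_real (gain l i) * chan S m i \<omega>)
     + herm (pilot S (pilot_of S l)) (ul_noise S m \<omega>)" for \<omega>
  define z2 where "z2 = (\<Sum>i\<in>UNIV - {k}. (gain l i)\<^sup>2 * beta' S m i) + tau_p S * ul_var S"
  have obs: "pilot_obs S m l \<omega> = of_real (gain l k) * chan S m k \<omega> + Z \<omega>" for \<omega>
    unfolding pilot_obs_eq Z_def by (subst sum.remove[of _ k]) auto
  have z2: "tau_p S * lambda' S m l = (gain l k)\<^sup>2 * beta' S m k + z2"
    unfolding lambda'_eq z2_def by (subst sum.remove[of _ k]) auto
  have Z: "has_bochner_integral (pspace S) Z 0"
    "has_bochner_integral (pspace S) (\<lambda>\<omega>. (cmod (Z \<omega>))\<^sup>2) z2"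
    "indep_var borel (chan S m k) borel Z"
    unfolding Z_def z2_def by (intro partial_obs_mean partial_obs_square partial_obs_indep; simp)+
  note facts = Z(3) chan_cmod_2 chan_cmod_4 chan_mean Z(1,2)
  show "has_bochner_integral (pspace S)
      (\<lambda>\<omega>. cnj (pilot_obs S m l \<omega>) * chan S m k \<omega>) (of_real (gain l k * beta' S m k))"
    unfolding obs by (rule mean_correlation[OF facts])
  \<comment> \<open>By \<open>z2\<close> the remainder has the power of the whole observation minus
    the share of UE \<open>k\<close>. That share cancels the squared second moment within the fourth
    moment, leaving a product of powers plus the Rician excess.\<close>
  have "(gain l k)\<^sup>2 * ((beta' S m k)\<^sup>2 + ((beta S m k)\<^sup>2 + 2 * (hbar S m k)\<^sup>2 * beta S m k)) + beta' S m k * z2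
      = tau_p S * lambda' S m l * beta' S m k
        + (gain l k)\<^sup>2 * ((beta S m k)\<^sup>2 + 2 * (hbar S m k)\<^sup>2 * beta S m k)"
    unfolding z2 by (simp add: algebra_simps power2_eq_square)
  then show "has_bochner_integral (pspace S)
      (\<lambda>\<omega>. (cmod (cnj (pilot_obs S m l \<omega>) * chan S m k \<omega>))\<^sup>2)
      (tau_p S * lambda' S m l * beta' S m k
        + (gain l k)\<^sup>2 * ((beta S m k)\<^sup>2 + 2 * (hbar S m k)\<^sup>2 * beta S m k))"
    using mean_square_correlation[OF facts, of "gain l k"] unfolding obs by simp
qed

text \<open>The block \<open>K m\<close> holds the projected noise and the channels of all UEs at AP
  \<open>m\<close>. Both factors are functions of it, and blocks of different APs are
  disjoint.\<close>

lemma obs_chan_indep: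
  "indep_vars (\<lambda>_. borel) (\<lambda>m \<omega>. cnj (pilot_obs S m l \<omega>) * chan S m k \<omega>) UNIV"
proof (rule indep_vars_group[OF source_indep[of "pilot_of S l"]])
  define K :: "'m \<Rightarrow> ('m + 'm \<times> 'k) set" where "K m = insert (Inl m) (range (\<lambda>i. Inr (m, i)))" for m
  show "disjoint_family_on K UNIV"
    by (auto simp: disjoint_family_on_def K_def)
  fix m
  show "(\<lambda>v. cnj ((\<Sum>i\<in>UNIV. of_real (gain l i) * v (Inr (m, i))) + v (Inl m)) * v (Inr (m, k)))
      \<in> borel_measurable (PiM (K m) (\<lambda>_. borel))"
    by (intro borel_measurable_times measurable_compose[OF _ borel_measurable_cnj] borel_measurable_add
        borel_measurable_sum borel_measurable_const measurable_component_singleton) (auto simp: K_def)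
  show "cnj (pilot_obs S m l \<omega>) * chan S m k \<omega> =
      cnj ((\<Sum>i\<in>UNIV. of_real (gain l i) * (\<lambda>j\<in>K m. source (pilot_of S l) j \<omega>) (Inr (m, i)))
        + (\<lambda>j\<in>K m. source (pilot_of S l) j \<omega>) (Inl m))
      * (\<lambda>j\<in>K m. source (pilot_of S l) j \<omega>) (Inr (m, k))" for \<omega>
    by (simp add: K_def source_def pilot_obs_eq)
qed simp

text \<open>Sums over APs have independent terms, so the total is the squared mean plus the
  variances; the squared means subtracted AP by AP produce the last, negative sum.\<close>

lemma
  fixes a :: "'m \<Rightarrow> real" and l k
  defines "y \<equiv> \<lambda>\<omega>. \<Sum>m\<in>UNIV. of_real (a m) * (cnj (pilot_obs S m l \<omega>) * chan S m k \<omega>)"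
  shows mr_mean: "has_bochner_integral (pspace S) y
          (of_real (gain l k * (\<Sum>m\<in>UNIV. a m * beta' S m k)))"
    and mr_square: "has_bochner_integral (pspace S) (\<lambda>\<omega>. (cmod (y \<omega>))\<^sup>2)
          (tau_p S * (\<Sum>m\<in>UNIV. (a m)\<^sup>2 * lambda' S m l * beta' S m k)
           + (gain l k)\<^sup>2 * ((\<Sum>m\<in>UNIV. (a m)\<^sup>2 * ((beta S m k)\<^sup>2 + 2 * (hbar S m k)\<^sup>2 * beta S m k))
               + (\<Sum>m\<in>UNIV. a m * beta' S m k)\<^sup>2 - (\<Sum>m\<in>UNIV. (a m)\<^sup>2 * (beta' S m k)\<^sup>2)))"
proof -
  define X where "X m \<omega> = of_real (a m) * (cnj (pilot_obs S m l \<omega>) * chan S m k \<omega>)" for m \<omega>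
  define \<mu> where "\<mu> m = complex_of_real (a m * (gain l k * beta' S m k))" for m
  have mean: "has_bochner_integral (pspace S) (X m) (\<mu> m)" for m
    using has_bochner_integral_mult_right[of "of_real (a m)", OF obs_chan_mean[of m l k]]
    by (simp add: X_def[abs_def] \<mu>_def)
  have sum_\<mu>: "(\<Sum>m\<in>UNIV. \<mu> m) = of_real (gain l k * (\<Sum>m\<in>UNIV. a m * beta' S m k))"
    by (simp add: \<mu>_def sum_distrib_left ac_simps)
  show "has_bochner_integral (pspace S) y (of_real (gain l k * (\<Sum>m\<in>UNIV. a m * beta' S m k)))"
    unfolding y_def sum_\<mu>[symmetric] X_def[symmetric] by (intro has_bochner_integral_sum mean)
  have sq: "has_bochner_integral (pspace S) (\<lambda>\<omega>. (cmod (X m \<omega>))\<^sup>2)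
      ((a m)\<^sup>2 * (tau_p S * lambda' S m l * beta' S m k
        + (gain l k)\<^sup>2 * ((beta S m k)\<^sup>2 + 2 * (hbar S m k)\<^sup>2 * beta S m k)))" for m
    using has_bochner_integral_mult_right[of "(a m)\<^sup>2", OF obs_chan_square[of m l k]]
    by (simp add: X_def norm_mult power_mult_distrib)
  have "indep_var borel (X i) borel (X j)" if "i \<noteq> j" for i j
    using indep_var_complex_compose[OF indep_vars_imp_indep_var[OF obs_chan_indep[of l k]],
        of i j "\<lambda>x. of_real (a i) * x" "\<lambda>x. of_real (a j) * x"] that
    by (simp add: X_def[abs_def])
  from has_bochner_integral_cmod_sum_square[of UNIV X, OF this mean sq]
  have "has_bochner_integral (pspace S) (\<lambda>\<omega>. (cmod (y \<omega>))\<^sup>2)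
      ((cmod (\<Sum>m\<in>UNIV. \<mu> m))\<^sup>2 + (\<Sum>m\<in>UNIV. (a m)\<^sup>2 * (tau_p S * lambda' S m l * beta' S m k
        + (gain l k)\<^sup>2 * ((beta S m k)\<^sup>2 + 2 * (hbar S m k)\<^sup>2 * beta S m k)) - (cmod (\<mu> m))\<^sup>2))"
    by (simp add: X_def y_def)
  moreover have "(cmod (\<Sum>m\<in>UNIV. \<mu> m))\<^sup>2 = (gain l k)\<^sup>2 * (\<Sum>m\<in>UNIV. a m * beta' S m k)\<^sup>2"
    unfolding sum_\<mu> by (simp only: norm_of_real power2_abs power_mult_distrib)
  moreover have "(cmod (\<mu> m))\<^sup>2 = (gain l k)\<^sup>2 * ((a m)\<^sup>2 * (beta' S m k)\<^sup>2)" for m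
    unfolding \<mu>_def by (simp only: norm_of_real power2_abs power_mult_distrib ac_simps)
  ultimately show "has_bochner_integral (pspace S) (\<lambda>\<omega>. (cmod (y \<omega>))\<^sup>2)
          (tau_p S * (\<Sum>m\<in>UNIV. (a m)\<^sup>2 * lambda' S m l * beta' S m k)
           + (gain l k)\<^sup>2 * ((\<Sum>m\<in>UNIV. (a m)\<^sup>2 * ((beta S m k)\<^sup>2 + 2 * (hbar S m k)\<^sup>2 * beta S m k))
               + (\<Sum>m\<in>UNIV. a m * beta' S m k)\<^sup>2 - (\<Sum>m\<in>UNIV. (a m)\<^sup>2 * (beta' S m k)\<^sup>2)))"
    by (simp add: algebra_simps sum.distrib sum_subtractf sum_distrib_left)
qed

end

section \<open>Diagonal matrices\<close>

lemma diag_mat_mult: "diag_mat a ** diag_mat b = diag_mat (\<lambda>i. a i * b i :: real)"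
  by (simp add: vec_eq_iff diag_mat_def matrix_matrix_mult_def
      if_distrib[of "\<lambda>x. x * _"] if_distrib[of "\<lambda>x. _ * x"] cong: if_cong)

lemma diag_mat_add: "diag_mat a + diag_mat b = diag_mat (\<lambda>i. a i + b i :: real)"
  by (simp add: vec_eq_iff diag_mat_def)

lemma diag_mat_scaleR: "r *\<^sub>R diag_mat a = diag_mat (\<lambda>i. r * a i :: real)"
  by (simp add: vec_eq_iff diag_mat_def)

lemma trace_diag_mat: "trace (diag_mat a) = (\<Sum>i\<in>UNIV. a i)"
  by (simp add: trace_def diag_mat_def)

text \<open>\<open>matrix_inv\<close> is a choice among two-sided inverses; evaluating the product
  of \<open>B\<close>, \<open>A\<close> and the chosen inverse in two ways shows that it is
  \<open>B\<close>.\<close>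

lemma matrix_inv_eqI:
  fixes A :: "'a::semiring_1 ^ 'n ^ 'n"
  assumes "A ** B = mat 1" "B ** A = mat 1"
  shows "matrix_inv A = B"
proof -
  have "A ** matrix_inv A = mat 1 \<and> matrix_inv A ** A = mat 1"
    unfolding matrix_inv_def by (rule someI[of _ B]) (use assms in simp)
  then have "B ** (A ** matrix_inv A) = B" by simp
  then show ?thesis
    by (simp add: matrix_mul_assoc assms)
qed

lemma matrix_inv_diag_mat:
  assumes "\<And>i. d i \<noteq> (0 :: real)"
  shows "matrix_inv (diag_mat d) = diag_mat (\<lambda>i. inverse (d i))"
proof -
  have "diag_mat (\<lambda>_. 1) = mat (1 :: real)" by (simp add: diag_mat_def mat_def)
  then show ?thesis
    by (intro matrix_inv_eqI) (simp_all add: diag_mat_mult assms)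
qed

lemma map_matrix_diag_mat_vec:
  "(map_matrix complex_of_real (diag_mat d) *v x) $ i = of_real (d i) * x $ i"
  by (simp add: matrix_vector_mult_def diag_mat_def if_distrib[of of_real]
      if_distrib[of "\<lambda>x. x * _"] cong: if_cong)

section \<open>MR precoding\<close>

lemma (in cell_free) tau_p_pos: "0 < tau_p S"
  by (simp add: tau_p_def)

text \<open>Positivity makes the diagonal matrix invertible, so inverting \<open>Lambda'_mat\<close>
  restores the entries \<open>lambda'\<close>.\<close>

lemma (in cell_free) lambda'_pos: "0 < lambda' S m k"
proof -
  have "0 \<le> ppow S l * tau_p S * beta' S m l" for l
    using ppow_pos[of l] beta_pos[of m l] tau_p_pos by (simp add: beta'_def)
  then show ?thesis
    unfolding lambda'_def using ul_var_pos by (intro add_nonneg_pos sum_nonneg)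
qed

theorem theorem6:
  fixes S :: "('w, 'm::finite, 'k::finite, 't::finite) network"
    and D :: "'k \<Rightarrow> real ^ 'm ^ 'm"
    and w :: "'k \<Rightarrow> 'w \<Rightarrow> complex ^ 'm"
    and T :: "'k \<Rightarrow> 'k \<Rightarrow> real"
  assumes net: "cell_free S"
    and D: "\<And>k. D k = diag_mat (\<lambda>m. rho S m k / (\<integral>\<omega>. (cmod (ls_est S m k \<omega>))\<^sup>2 \<partial>pspace S))"
    and w: "\<And>k \<omega>. w k \<omega> = map_matrix complex_of_real (diag_sqrt (D k)) *v ls_est_vec S k \<omega>"
    and T: "\<And>k l. T k l = ppow S k / ppow S l *
              (trace (D l ** (R_mat S k ** R_mat S k + 2 *\<^sub>R (L_mat S k ** R_mat S k)))
               + \<bar>trace (diag_sqrt (D l) ** R'_mat S k)\<bar>\<^sup>2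
               - trace (D l ** (R'_mat S k ** R'_mat S k)))"
  shows "(\<forall>m k. integrable (pspace S) (\<lambda>\<omega>. (cmod (ls_est S m k \<omega>))\<^sup>2)) \<and>
    (\<forall>k. integrable (pspace S) (\<lambda>\<omega>. herm (w k \<omega>) (chan_vec S k \<omega>)) \<and>
         (\<integral>\<omega>. herm (w k \<omega>) (chan_vec S k \<omega>) \<partial>pspace S)
           = complex_of_real (trace (diag_sqrt (D k) ** R'_mat S k))) \<and>
    (\<forall>k l. integrable (pspace S) (\<lambda>\<omega>. (cmod (herm (w l \<omega>) (chan_vec S k \<omega>)))\<^sup>2) \<and>
         (\<integral>\<omega>. (cmod (herm (w l \<omega>) (chan_vec S k \<omega>)))\<^sup>2 \<partial>pspace S)
           = 1 / (ppow S l * tau_p S) * trace (D l ** matrix_inv (Lambda'_mat S l) ** R'_mat S k)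
             + (if l \<in> copilot S k then T k l else 0)) \<and>
    (\<forall>k. dl_coh_sinr S w k =
         \<bar>trace (diag_sqrt (D k) ** R'_mat S k)\<bar>\<^sup>2 /
         ((\<Sum>l\<in>UNIV. 1 / (ppow S l * tau_p S)
              * trace (D l ** matrix_inv (Lambda'_mat S l) ** R'_mat S k))
          + (\<Sum>l\<in>copilot S k. T k l)
          - \<bar>trace (diag_sqrt (D k) ** R'_mat S k)\<bar>\<^sup>2
          + dl_var S))"
proof -
  interpret cell_free S by (rule net)
  define d where "d l m = rho S m l / (\<integral>\<omega>. (cmod (ls_est S m l \<omega>))\<^sup>2 \<partial>pspace S)" for l m
  have D_eq: "D l = diag_mat (d l)" for l by (simp add: D d_def[abs_def])
  \<comment> \<open>This makes the square of \<open>sqrt (d l m)\<close> equal to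
    \<open>d l m\<close>.\<close>
  have d_nonneg: "0 \<le> d l m" for l m
    by (simp add: d_def rho_nonneg)
  \<comment> \<open>Integrability ensures that the expectation in \<open>D\<close> is a genuine one
    and not the default value 0.\<close>
  have ls_int: "integrable (pspace S) (\<lambda>\<omega>. (cmod (ls_est S m k \<omega>))\<^sup>2)" for m k
    using integrable_mult_right[of "(1 / (sqrt (ppow S k) * tau_p S))\<^sup>2", OF has_bochner_integral_iff[THEN iffD1, OF pilot_obs_square[of m k], THEN conjunct1]]
    by (simp add: ls_est_def norm_mult norm_divide power_mult_distrib power_divide)
  \<comment> \<open>\<open>q\<close> is the LS scaling; extracting it turns the precoded signal into
    a sum over APs with real weights.\<close>
  define q where "q l = 1 / (sqrt (ppow S l) * tau_p S)" for l
  have q2: "(q l)\<^sup>2 = 1 / (ppow S l * (tau_p S)\<^sup>2)" for l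
    using ppow_pos[of l] by (simp add: q_def power_divide power_mult_distrib)
  have herm_eq: "herm (w l \<omega>) (chan_vec S k \<omega>) =
      (\<Sum>m\<in>UNIV. of_real (q l * sqrt (d l m)) * (cnj (pilot_obs S m l \<omega>) * chan S m k \<omega>))" for l k \<omega>
    unfolding herm_def w D_eq diag_sqrt_diag_mat map_matrix_diag_mat_vec
    by (simp add: ls_est_vec_def chan_vec_def ls_est_def q_def ac_simps)
  have R': "R'_mat S k = diag_mat (\<lambda>m. beta' S m k)" for k
    by (simp add: R'_mat_def R_mat_def L_mat_def diag_mat_add beta'_def)
  have tr: "trace (diag_sqrt (D l) ** R'_mat S k) = (\<Sum>m\<in>UNIV. sqrt (d l m) * beta' S m k)" for l k
    by (simp add: D_eq diag_sqrt_diag_mat R' diag_mat_mult trace_diag_mat)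
  have "matrix_inv (Lambda'_mat S l) = diag_mat (\<lambda>m. lambda' S m l)" for l
    using lambda'_pos[of _ l] by (simp add: Lambda'_mat_def matrix_inv_diag_mat less_imp_neq[symmetric])
  then have tr_lambda: "trace (D l ** matrix_inv (Lambda'_mat S l) ** R'_mat S k)
      = (\<Sum>m\<in>UNIV. d l m * lambda' S m l * beta' S m k)" for l k
    by (simp add: D_eq R' diag_mat_mult trace_diag_mat)
  have T_eq: "T k l = ppow S k / ppow S l *
      ((\<Sum>m\<in>UNIV. d l m * ((beta S m k)\<^sup>2 + 2 * (hbar S m k)\<^sup>2 * beta S m k))
       + (\<Sum>m\<in>UNIV. sqrt (d l m) * beta' S m k)\<^sup>2
       - (\<Sum>m\<in>UNIV. d l m * (beta' S m k)\<^sup>2))" for k l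
    unfolding T tr unfolding R_mat_def L_mat_def D_eq R'
    by (simp add: diag_mat_mult diag_mat_add diag_mat_scaleR trace_diag_mat power2_eq_square mult.assoc)
  \<comment> \<open>The LS scaling cancels the gain of the UE's own channel, so the mean carries no
    prefactor.\<close>
  have gain_self: "gain k k * q k = 1" for k
    using ppow_pos[of k] tau_p_pos by (simp add: gain_def copilot_def q_def)
  have mean: "has_bochner_integral (pspace S) (\<lambda>\<omega>. herm (w k \<omega>) (chan_vec S k \<omega>))
      (of_real (trace (diag_sqrt (D k) ** R'_mat S k)))" for k
  proof -
    have "gain k k * (\<Sum>m\<in>UNIV. q k * sqrt (d k m) * beta' S m k)
        = (gain k k * q k) * trace (diag_sqrt (D k) ** R'_mat S k)"
      by (simp add: tr sum_distrib_left mult.assoc)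
    then show ?thesis
      using mr_mean[of "\<lambda>m. q k * sqrt (d k m)" k k] by (simp only: herm_eq gain_self mult_1)
  qed
  have square: "has_bochner_integral (pspace S) (\<lambda>\<omega>. (cmod (herm (w l \<omega>) (chan_vec S k \<omega>)))\<^sup>2)
      (1 / (ppow S l * tau_p S) * trace (D l ** matrix_inv (Lambda'_mat S l) ** R'_mat S k)
             + (if l \<in> copilot S k then T k l else 0))" for k l
  proof -
    have a2: "(q l * sqrt (d l m))\<^sup>2 = (q l)\<^sup>2 * d l m" for m
      using d_nonneg[of l m] by (simp add: power_mult_distrib)
    have e1: "tau_p S * (\<Sum>m\<in>UNIV. (q l)\<^sup>2 * d l m * lambda' S m l * beta' S m k)
        = tau_p S * (q l)\<^sup>2 * (\<Sum>m\<in>UNIV. d l m * lambda' S m l * beta' S m k)"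
      by (simp add: sum_distrib_left mult.assoc)
    have e2: "tau_p S * (q l)\<^sup>2 = 1 / (ppow S l * tau_p S)"
      unfolding q2 using tau_p_pos by (simp add: power2_eq_square)
    have e3: "(gain l k)\<^sup>2 * ((\<Sum>m\<in>UNIV. (q l)\<^sup>2 * d l m * ((beta S m k)\<^sup>2 + 2 * (hbar S m k)\<^sup>2 * beta S m k))
               + (\<Sum>m\<in>UNIV. q l * sqrt (d l m) * beta' S m k)\<^sup>2 - (\<Sum>m\<in>UNIV. (q l)\<^sup>2 * d l m * (beta' S m k)\<^sup>2))
        = (gain l k)\<^sup>2 * (q l)\<^sup>2 * ((\<Sum>m\<in>UNIV. d l m * ((beta S m k)\<^sup>2 + 2 * (hbar S m k)\<^sup>2 * beta S m k))
       + (\<Sum>m\<in>UNIV. sqrt (d l m) * beta' S m k)\<^sup>2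
       - (\<Sum>m\<in>UNIV. d l m * (beta' S m k)\<^sup>2))"
      by (simp add: mult.assoc flip: sum_distrib_left) (simp add: power_mult_distrib algebra_simps)
    \<comment> \<open>The pilot lengths cancel and leave the power ratio. Sharing a pilot is
      symmetric, so the condition in \<open>gain_square\<close> can be stated with \<open>k\<close>
      and \<open>l\<close> exchanged.\<close>
    have e4: "(gain l k)\<^sup>2 * (q l)\<^sup>2 = (if l \<in> copilot S k then ppow S k / ppow S l else 0)"
      using tau_p_pos by (auto simp: gain_square q2 copilot_def)
    from mr_square[of "\<lambda>m. q l * sqrt (d l m)" l k] show ?thesis
      unfolding a2 e1 e2 e3 e4
      by (cases "l \<in> copilot S k")
        (simp_all only: herm_eq tr_lambda T_eq if_True if_False mult_zero_left)
  qed
  have "(\<Sum>l\<in>UNIV. \<integral>\<omega>. (cmod (herm (w l \<omega>) (chan_vec S k \<omega>)))\<^sup>2 \<partial>pspace S)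
      = (\<Sum>l\<in>UNIV. 1 / (ppow S l * tau_p S) * trace (D l ** matrix_inv (Lambda'_mat S l) ** R'_mat S k))
        + (\<Sum>l\<in>copilot S k. T k l)" for k
    unfolding has_bochner_integral_integral_eq[OF square] by (simp add: sum.distrib sum.If_cases)
  then show ?thesis
    using ls_int mean square
    by (simp add: has_bochner_integral_iff dl_coh_sinr_def)
qed

end
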